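(* Let $\Omega\subset\mathbb{R}^{d}$ be open, let $T\in\mathcal{D}'(\Omega)$, let $k\in\mathbb{N}$, and let $(f_{n})$ be a sequence of $C^{k}$ functions on $\Omega$ that is associated to $T$, i.e. $f_{n}\to T$ in the weak topology of $\mathcal{D}'(\Omega)$. Assume that either of the following pairs of conditions holds: (i) $(f_{n})\in\mathcal{E}^{k,a}_{\mathbb{N}}(\Omega)$ for every $a>0$, that is, for every $a>0$, every $\omega\subset\subset\Omega$ and every $m\in\mathbb{N}^{d}$ with $|m|\leq k$, $\sup_{x\in\omega}|\partial^{m}f_{n}(x)|=O(n^{a})$; and there exists $b>0$ such that $T-f_{n}=O(n^{-b})$ in $\mathcal{D}'(\Omega)$. (ii) $(f_{n})\in\mathcal{E}^{k,s}_{\mathbb{N}}(\Omega)$ for some $s>0$; and there is a rapidly decreasing function $R:\mathbb{N}\to\mathbb{R}_{+}$, i.e. $R(n)=O(n^{-a})$ for every $a>0$, such that $T-f_{n}=O(R(n))$ in $\mathcal{D}'(\Omega)$. Then $T\in C^{k-\eta}_{\ast,loc}(\Omega)$ for every $\eta>0$.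
   Context: $\mathbb{N}$ includes $0$; sequences are indexed by integers $n\geq1$, and all $O$-estimates are as $n\to\infty$. We write $\omega\subset\subset\Omega$ if $\omega$ has compact closure contained in $\Omega$. The class $\mathcal{E}^{k,s}_{\mathbb{N}}(\Omega)$: the set of all sequences $(f_{n})$ of $C^{k}$ functions on $\Omega$ such that for every $\omega\subset\subset\Omega$ and every $m\in\mathbb{N}^{d}$ with $|m|\leq k$ one has $\sup_{x\in\omega}|\partial^{m}f_{n}(x)|=O(n^{s})$. Rate of convergence: for $R:\mathbb{N}\to\mathbb{R}_{+}$ with $R(n)=o(1)$, the notation $T-f_{n}=O(R(n))$ in $\mathcal{D}'(\Omega)$ means that for each $\rho\in\mathcal{D}(\Omega)$ one has $\langle T-f_{n},\rho\rangle=O(R(n))$ as $n\to\infty$ (the constant may depend on $\rho$). The global Zygmund space $C^{\beta}_{\ast}(\mathbb{R}^{d})$, $\beta\in\mathbb{R}$: let $\varepsilon>0$ and choose $\theta_{1},\theta\in\mathcal{S}(\mathbb{R}^{d})$ with $|\hat{\theta}_{1}(u)|>0$ for $|u|\leq2\varepsilon$, $|\hat{\theta}(u)|>0$ for $\varepsilon/2\leq|u|\leq2\varepsilon$, and $\int_{\mathbb{R}^{d}}x^{m}\theta(x)\,dx=0$ for all multi-indices $|m|\leq[\beta]$, where $[\beta]$ is the integral part of $\beta$ (no moment condition is required if $\beta<0$). Put $\theta_{2^{0}}=\theta_{1}$ and $\theta_{2^{j}}(x)=2^{jd}\theta(2^{j}x)$ for $j\geq1$. Then $C^{\beta}_{\ast}(\mathbb{R}^{d})$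 is the space of all $T\in\mathcal{S}'(\mathbb{R}^{d})$ with $$\sup_{x\in\mathbb{R}^{d},\,j\geq0}2^{\beta j}|(T\ast\theta_{2^{j}})(x)|<\infty.$$ It is known that this space does not depend on the choice of $\varepsilon,\theta_{1},\theta$ satisfying these conditions. The local Zygmund space: $T\in\mathcal{D}'(\Omega)$ belongs to $C^{\beta}_{\ast,loc}(\Omega)$ if $\rho T\in C^{\beta}_{\ast}(\mathbb{R}^{d})$ for all $\rho\in\mathcal{D}(\Omega)$ (with $\rho T$ extended by zero to $\mathbb{R}^{d}$). *)

theory Defs
  imports "HOL-Analysis.Analysis" "HOL-Library.Landau_Symbols"
begin

section \<open>Multi-indices and partial derivatives\<close>

text \<open>The space $\mathbb{R}^d$ is a type of class \<open>euclidean_space\<close> with \<open>d = DIM('a)\<close>. A multi-index is a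
  function on the standard basis, extended by zero so that there are only finitely many of each order.\<close>

definition multi_indices :: "('a::euclidean_space \<Rightarrow> nat) set"
  where "multi_indices = {m. \<forall>b. b \<notin> Basis \<longrightarrow> m b = 0}"

definition order_mi :: "('a::euclidean_space \<Rightarrow> nat) \<Rightarrow> nat"
  where "order_mi m = (\<Sum>b\<in>Basis. m b)"

definition monomial :: "('a::euclidean_space \<Rightarrow> nat) \<Rightarrow> 'a \<Rightarrow> real"
  where "monomial m x = (\<Prod>b\<in>Basis. (x \<bullet> b) ^ m b)"

definition partial_deriv :: "'a::euclidean_space \<Rightarrow> ('a \<Rightarrow> complex) \<Rightarrow> 'a \<Rightarrow> complex"
  where "partial_deriv b f = (\<lambda>x. frechet_derivative f (at x) b)"

definition basis_enum :: "'a::euclidean_space list"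
  where "basis_enum = (SOME bs. distinct bs \<and> set bs = Basis)"

lemma basis_enum: "distinct (basis_enum :: 'a::euclidean_space list)"
    "set (basis_enum :: 'a list) = Basis"
proof -
  have "\<exists>bs :: 'a list. distinct bs \<and> set bs = Basis"
    using finite_distinct_list[OF finite_Basis] by blast
  from someI_ex[OF this] show "distinct (basis_enum :: 'a list)" "set (basis_enum :: 'a list) = Basis"
    unfolding basis_enum_def by auto
qed

text \<open>$\partial^m = \partial_1^{m_1} \cdots \partial_d^{m_d}$ for a fixed enumeration of the coordinate
  directions. It is only applied to functions of class $C^{|m|}$, for which the order is immaterial.\<close>

definition mi_deriv :: "('a::euclidean_space \<Rightarrow> nat) \<Rightarrow> ('a \<Rightarrow> complex) \<Rightarrow> 'a \<Rightarrow> complex"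
  where "mi_deriv m f = foldr (\<lambda>b g. (partial_deriv b ^^ m b) g) basis_enum f"

text \<open>Functions of class $C^k$ on an open set; the values of \<open>f\<close> off \<open>S\<close> are irrelevant.\<close>

primrec Ck_on :: "nat \<Rightarrow> 'a::euclidean_space set \<Rightarrow> ('a \<Rightarrow> complex) \<Rightarrow> bool" where
  "Ck_on 0 S f \<longleftrightarrow> continuous_on S f"
| "Ck_on (Suc k) S f \<longleftrightarrow>
     (\<forall>x\<in>S. f differentiable (at x)) \<and> (\<forall>b\<in>Basis. Ck_on k S (partial_deriv b f))"

definition smooth_on :: "'a::euclidean_space set \<Rightarrow> ('a \<Rightarrow> complex) \<Rightarrow> bool"
  where "smooth_on S f \<longleftrightarrow> (\<forall>k. Ck_on k S f)"


section \<open>Distributions\<close>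

definition supp :: "('a::euclidean_space \<Rightarrow> complex) \<Rightarrow> 'a set"
  where "supp \<phi> = closure {x. \<phi> x \<noteq> 0}"

definition test_functions :: "'a::euclidean_space set \<Rightarrow> ('a \<Rightarrow> complex) set"
  where "test_functions \<Omega> = {\<phi>. smooth_on UNIV \<phi> \<and> compact (supp \<phi>) \<and> supp \<phi> \<subseteq> \<Omega>}"

definition schwartz_functions :: "('a::euclidean_space \<Rightarrow> complex) set"
  where "schwartz_functions = {\<phi>. smooth_on UNIV \<phi> \<and>
    (\<forall>\<alpha>\<in>multi_indices. \<forall>m\<in>multi_indices.
       bdd_above (range (\<lambda>x. norm (of_real (monomial \<alpha> x) * mi_deriv m \<phi> x))))}"

definition linear_functional_on ::
    "('a::euclidean_space \<Rightarrow> complex) set \<Rightarrow> (('a \<Rightarrow> complex) \<Rightarrow> complex) \<Rightarrow> bool"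
  where "linear_functional_on V T \<longleftrightarrow>
    (\<forall>\<phi>\<in>V. \<forall>\<psi>\<in>V. T (\<lambda>x. \<phi> x + \<psi> x) = T \<phi> + T \<psi>) \<and>
    (\<forall>c. \<forall>\<phi>\<in>V. T (\<lambda>x. c * \<phi> x) = c * T \<phi>)"

text \<open>Functionals are total HOL functions, so only their values on \<open>test_functions \<Omega>\<close> (respectively
  on \<open>schwartz_functions\<close>) carry information. Continuity is expressed by the usual seminorm estimates.\<close>

definition distributions :: "'a::euclidean_space set \<Rightarrow> (('a \<Rightarrow> complex) \<Rightarrow> complex) set"
  where "distributions \<Omega> = {T. linear_functional_on (test_functions \<Omega>) T \<and>
    (\<forall>K. compact K \<and> K \<subseteq> \<Omega> \<longrightarrow>
      (\<exists>C N. \<forall>\<phi>\<in>test_functions \<Omega>. supp \<phi> \<subseteq> K \<longrightarrow>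
        norm (T \<phi>) \<le> C * (\<Sum>m | m \<in> multi_indices \<and> order_mi m \<le> N. SUP x. norm (mi_deriv m \<phi> x))))}"

definition tempered_distributions :: "(('a::euclidean_space \<Rightarrow> complex) \<Rightarrow> complex) set"
  where "tempered_distributions = {T. linear_functional_on schwartz_functions T \<and>
    (\<exists>C N. \<forall>\<phi>\<in>schwartz_functions.
      norm (T \<phi>) \<le> C * (\<Sum>\<alpha> | \<alpha> \<in> multi_indices \<and> order_mi \<alpha> \<le> N.
        \<Sum>m | m \<in> multi_indices \<and> order_mi m \<le> N.
          SUP x. norm (of_real (monomial \<alpha> x) * mi_deriv m \<phi> x)))}"

definition regular_distr ::
    "'a::euclidean_space set \<Rightarrow> ('a \<Rightarrow> complex) \<Rightarrow> ('a \<Rightarrow> complex) \<Rightarrow> complex"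
  where "regular_distr \<Omega> f \<phi> = (LINT x:\<Omega>|lborel. f x * \<phi> x)"

text \<open>For \<open>\<rho> \<in> test_functions \<Omega>\<close> and \<open>T \<in> distributions \<Omega>\<close> this is also the extension of $\rho T$ by zero
  to the whole space, because \<open>\<rho> \<phi>\<close> is in \<open>test_functions \<Omega>\<close> for every smooth \<open>\<phi>\<close>.\<close>

definition mult_distr ::
    "('a::euclidean_space \<Rightarrow> complex) \<Rightarrow> (('a \<Rightarrow> complex) \<Rightarrow> complex) \<Rightarrow> ('a \<Rightarrow> complex) \<Rightarrow> complex"
  where "mult_distr \<rho> T \<phi> = T (\<lambda>x. \<rho> x * \<phi> x)"

definition conv_distr ::
    "(('a::euclidean_space \<Rightarrow> complex) \<Rightarrow> complex) \<Rightarrow> ('a \<Rightarrow> complex) \<Rightarrow> 'a \<Rightarrow> complex"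
  where "conv_distr T \<theta> x = T (\<lambda>y. \<theta> (x - y))"


section \<open>Sequences of functions\<close>

text \<open>Sequences are indexed by \<open>n \<ge> 1\<close>; the entry at \<open>0\<close> is unconstrained.\<close>

definition compactly_inside :: "'a::euclidean_space set \<Rightarrow> 'a set \<Rightarrow> bool"
  where "compactly_inside \<omega> \<Omega> \<longleftrightarrow> compact (closure \<omega>) \<and> closure \<omega> \<subseteq> \<Omega>"

text \<open>The empty \<open>\<omega>\<close> is left out only because the supremum of the empty set of reals is unspecified.\<close>

definition E_class :: "nat \<Rightarrow> real \<Rightarrow> 'a::euclidean_space set \<Rightarrow> (nat \<Rightarrow> 'a \<Rightarrow> complex) set"
  where "E_class k s \<Omega> = {f. (\<forall>n\<ge>1. Ck_on k \<Omega> (f n)) \<and>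
    (\<forall>\<omega>. \<omega> \<noteq> {} \<and> compactly_inside \<omega> \<Omega> \<longrightarrow>
      (\<forall>m\<in>multi_indices. order_mi m \<le> k \<longrightarrow>
        (\<lambda>n. SUP x\<in>\<omega>. norm (mi_deriv m (f n) x)) \<in> O(\<lambda>n. real n powr s)))}"

definition associated ::
    "'a::euclidean_space set \<Rightarrow> (('a \<Rightarrow> complex) \<Rightarrow> complex) \<Rightarrow> (nat \<Rightarrow> 'a \<Rightarrow> complex) \<Rightarrow> bool"
  where "associated \<Omega> T f \<longleftrightarrow>
    (\<forall>\<rho>\<in>test_functions \<Omega>. (\<lambda>n. regular_distr \<Omega> (f n) \<rho>) \<longlonglongrightarrow> T \<rho>)"

definition convergence_rate ::
    "'a::euclidean_space set \<Rightarrow> (('a \<Rightarrow> complex) \<Rightarrow> complex) \<Rightarrow> (nat \<Rightarrow> 'a \<Rightarrow> complex) \<Rightarrow> (nat \<Rightarrow> real) \<Rightarrow> bool"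
  where "convergence_rate \<Omega> T f R \<longleftrightarrow>
    (\<forall>\<rho>\<in>test_functions \<Omega>. (\<lambda>n. norm (T \<rho> - regular_distr \<Omega> (f n) \<rho>)) \<in> O(R))"

definition rapidly_decreasing :: "(nat \<Rightarrow> real) \<Rightarrow> bool"
  where "rapidly_decreasing R \<longleftrightarrow> (\<forall>a>0. R \<in> O(\<lambda>n. real n powr (- a)))"


section \<open>Zygmund spaces\<close>

definition fourier :: "('a::euclidean_space \<Rightarrow> complex) \<Rightarrow> 'a \<Rightarrow> complex"
  where "fourier \<theta> u = (LINT x|lborel. \<theta> x * cis (- (x \<bullet> u)))"

text \<open>For \<open>\<beta> < 0\<close> the floor is negative and the moment condition is void.\<close>

definition zygmund_admissible ::
    "real \<Rightarrow> real \<Rightarrow> ('a::euclidean_space \<Rightarrow> complex) \<Rightarrow> ('a \<Rightarrow> complex) \<Rightarrow> bool"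
  where "zygmund_admissible \<beta> \<epsilon> \<theta>\<^sub>1 \<theta> \<longleftrightarrow>
    \<epsilon> > 0 \<and> \<theta>\<^sub>1 \<in> schwartz_functions \<and> \<theta> \<in> schwartz_functions \<and>
    (\<forall>u. norm u \<le> 2 * \<epsilon> \<longrightarrow> norm (fourier \<theta>\<^sub>1 u) > 0) \<and>
    (\<forall>u. \<epsilon> / 2 \<le> norm u \<and> norm u \<le> 2 * \<epsilon> \<longrightarrow> norm (fourier \<theta> u) > 0) \<and>
    (\<forall>m\<in>multi_indices. int (order_mi m) \<le> \<lfloor>\<beta>\<rfloor> \<longrightarrow>
       (LINT x|lborel. of_real (monomial m x) * \<theta> x) = 0)"

definition dyadic ::
    "('a::euclidean_space \<Rightarrow> complex) \<Rightarrow> ('a \<Rightarrow> complex) \<Rightarrow> nat \<Rightarrow> 'a \<Rightarrow> complex"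
  where "dyadic \<theta>\<^sub>1 \<theta> j =
    (if j = 0 then \<theta>\<^sub>1 else (\<lambda>x. of_real (2 ^ (j * DIM('a))) * \<theta> (2 ^ j *\<^sub>R x)))"

text \<open>The space does not depend on the admissible choice of \<open>\<epsilon>\<close>, \<open>\<theta>\<^sub>1\<close>, \<open>\<theta>\<close>, and such choices exist for
  every \<open>\<beta>\<close> (for instance $\hat\theta_1(u) = e^{-|u|^2}$ and
  $\hat\theta(u) = |u|^{2M} e^{-|u|^2}$ with $2M > \beta$). The bound is required for all of them, so that
  membership gives the estimate for whichever choice one works with.\<close>

definition zygmund :: "real \<Rightarrow> (('a::euclidean_space \<Rightarrow> complex) \<Rightarrow> complex) set"
  where "zygmund \<beta> = {T \<in> tempered_distributions.
    \<forall>\<epsilon> \<theta>\<^sub>1 \<theta>. zygmund_admissible \<beta> \<epsilon> \<theta>\<^sub>1 \<theta> \<longrightarrow>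
      (\<exists>C. \<forall>x j. 2 powr (\<beta> * real j) * norm (conv_distr T (dyadic \<theta>\<^sub>1 \<theta> j) x) \<le> C)}"

definition zygmund_loc ::
    "real \<Rightarrow> 'a::euclidean_space set \<Rightarrow> (('a \<Rightarrow> complex) \<Rightarrow> complex) set"
  where "zygmund_loc \<beta> \<Omega> =
    {T \<in> distributions \<Omega>. \<forall>\<rho>\<in>test_functions \<Omega>. mult_distr \<rho> T \<in> zygmund \<beta>}"

end

theory Submission
  imports Defs "HOL-Real_Asymp.Real_Asymp"
begin

text \<open>Fix \<open>\<rho> \<in> \<D>(\<Omega>)\<close> with support \<open>K\<close>, put \<open>\<beta> = k - \<eta>\<close>, and write \<open>\<theta>\<^sub>j\<close> for the dyadic dilates. For every \<open>n\<close>,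
  \<open>(\<rho>T * \<theta>\<^sub>j)(x) = (T - f\<^sub>n)(\<rho> \<theta>\<^sub>j(x - \<cdot>)) + \<integral> f\<^sub>n(y) \<rho>(y) \<theta>\<^sub>j(x - y) dy\<close>.

  For the first term the rate of convergence, given for each test function separately, has to be made
  uniform. The functionals \<open>(T - f\<^sub>n) / R(n)\<close> are continuous and pointwise bounded on the Frechet space of
  smooth functions that vanish off \<open>K\<close>. By the uniform boundedness principle
  (\<open>uniform_boundedness_test_in\<close>, \<open>uniform_convergence_rate\<close>) there are \<open>C\<close> and \<open>N\<close> such that
  \<open>\<bar>(T - f\<^sub>n)(\<phi>)\<bar> \<le> C R(n) M\<close> whenever all derivatives of \<open>\<phi>\<close> of order at most \<open>N\<close> are bounded by
  \<open>M\<close>. Hence the first term is at most a constant times \<open>R(n) 2\<^sup>j\<^sup>Q\<close> with \<open>Q = d + N\<close>.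

  For the second term let \<open>l\<close> be the least natural number greater than \<open>\<beta>\<close>; then \<open>l \<le> k\<close>, and the moments
  of \<open>\<theta>\<close> of order less than \<open>l\<close> vanish. Subtracting the Taylor polynomial of \<open>\<rho> f\<^sub>n\<close> of degree less than \<open>l\<close>
  does not change the integral, which is therefore at most a constant times \<open>n\<^sup>s (2\<^sup>-\<^sup>j)\<^sup>l\<close>
  (\<open>vanishing_moments_estimate\<close>, \<open>regular_part_estimate\<close>).

  Finally \<open>n\<close> is chosen in terms of \<open>j\<close>. With \<open>\<delta> = l - \<beta> > 0\<close> and \<open>n\<close> about \<open>2\<close> to the power
  \<open>j \<delta> / s\<close>, the second term times \<open>2 powr (\<beta> j)\<close> is bounded; if \<open>R(n) = O(n powr (- b))\<close> with
  \<open>b \<delta> \<ge> s (Q + \<beta>)\<close>, so is the first (\<open>balance_index\<close>). Under the first pair of conditions \<open>b\<close> is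
  given and \<open>s\<close> can be taken small; under the second \<open>s\<close> is given and \<open>b\<close> can be taken large
  (\<open>rate_exponents\<close>).\<close>

section \<open>Iterated partial derivatives\<close>

lemma partial_deriv_cong:
  assumes "open S" "x \<in> S" "\<And>y. y \<in> S \<Longrightarrow> f y = g y"
  shows "partial_deriv b f x = partial_deriv b g x"
proof -
  have "(f has_derivative D) (at x) \<longleftrightarrow> (g has_derivative D) (at x)" for D
    using has_derivative_transform_within_open[of f D x UNIV S g]
      has_derivative_transform_within_open[of g D x UNIV S f] assms by auto
  then show ?thesis unfolding partial_deriv_def frechet_derivative_def by simp
qed

lemma partial_deriv_eqI: "(f has_derivative D) (at x) \<Longrightarrow> partial_deriv b f x = D b"
  unfolding partial_deriv_def by (metis frechet_derivative_at)

lemma partial_deriv_add: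
  assumes "f differentiable (at x)" "g differentiable (at x)"
  shows "partial_deriv b (\<lambda>x. f x + g x) x = partial_deriv b f x + partial_deriv b g x"
  using has_derivative_add[OF assms[unfolded frechet_derivative_works]]
  by (simp add: partial_deriv_eqI partial_deriv_def[of b f] partial_deriv_def[of b g])

lemma partial_deriv_mult:
  assumes "f differentiable (at x)" "g differentiable (at x)"
  shows "partial_deriv b (\<lambda>x. f x * g x) x = partial_deriv b f x * g x + f x * partial_deriv b g x"
  using has_derivative_mult[OF assms[unfolded frechet_derivative_works]]
  by (simp add: partial_deriv_eqI partial_deriv_def[of b f] partial_deriv_def[of b g])

lemma partial_deriv_const [simp]: "partial_deriv b (\<lambda>x. c) = (\<lambda>x. 0)"
  by (simp add: partial_deriv_def fun_eq_iff)

lemma Ck_on_cong: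
  assumes "open S" "\<And>y. y \<in> S \<Longrightarrow> f y = g y"
  shows "Ck_on k S f \<longleftrightarrow> Ck_on k S g"
  using assms(2)
proof (induction k arbitrary: f g)
  case 0
  then show ?case by (auto cong: continuous_on_cong)
next
  case (Suc k)
  have "f differentiable (at x) \<longleftrightarrow> g differentiable (at x)" if "x \<in> S" for x
    unfolding differentiable_def
    using has_derivative_transform_within_open[of f _ x UNIV S g]
      has_derivative_transform_within_open[of g _ x UNIV S f] assms(1) that Suc.prems by metis
  moreover have "Ck_on k S (partial_deriv b f) \<longleftrightarrow> Ck_on k S (partial_deriv b g)" for b
    by (rule Suc.IH) (use assms(1) Suc.prems in \<open>auto intro: partial_deriv_cong\<close>)
  ultimately show ?case by auto
qed

lemma Ck_on_Suc_imp: "Ck_on (Suc k) S f \<Longrightarrow> Ck_on k S f"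
proof (induction k arbitrary: f)
  case 0
  then show ?case
    by (auto intro!: continuous_at_imp_continuous_on differentiable_imp_continuous_within)
next
  case (Suc k)
  then show ?case by (metis Ck_on.simps(2))
qed

lemma Ck_on_mono: "Ck_on k S f \<Longrightarrow> l \<le> k \<Longrightarrow> Ck_on l S f"
proof (induction k)
  case (Suc k)
  then show ?case using Ck_on_Suc_imp le_Suc_eq by blast
qed auto

lemma Ck_on_continuous: "Ck_on k S f \<Longrightarrow> continuous_on S f"
  using Ck_on_mono[of k S f 0] by simp

lemma Ck_on_subset: "Ck_on k S f \<Longrightarrow> U \<subseteq> S \<Longrightarrow> Ck_on k U f"
  by (induction k arbitrary: f) (auto intro: continuous_on_subset)

lemma Ck_on_Un: "open S \<Longrightarrow> open U \<Longrightarrow> Ck_on k S f \<Longrightarrow> Ck_on k U f \<Longrightarrow> Ck_on k (S \<union> U) f"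
  by (induction k arbitrary: f) (auto intro: continuous_on_open_Un)

lemma Ck_on_const: "Ck_on k S (\<lambda>x. c)"
  by (induction k arbitrary: c) auto

lemma Ck_on_add: "open S \<Longrightarrow> Ck_on k S f \<Longrightarrow> Ck_on k S g \<Longrightarrow> Ck_on k S (\<lambda>x. f x + g x)"
proof (induction k arbitrary: f g)
  case (Suc k)
  have "Ck_on k S (partial_deriv b (\<lambda>x. f x + g x))" if "b \<in> Basis" for b
    using Suc that
    by (subst Ck_on_cong[where g="\<lambda>x. partial_deriv b f x + partial_deriv b g x"])
      (auto simp: partial_deriv_add)
  then show ?case using Suc.prems by auto
qed (auto intro: continuous_on_add)

lemma Ck_on_mult: "open S \<Longrightarrow> Ck_on k S f \<Longrightarrow> Ck_on k S g \<Longrightarrow> Ck_on k S (\<lambda>x. f x * g x)"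
proof (induction k arbitrary: f g)
  case (Suc k)
  have fg: "Ck_on k S f" "Ck_on k S g" using Suc.prems Ck_on_Suc_imp by blast+
  have "Ck_on k S (partial_deriv b (\<lambda>x. f x * g x))" if "b \<in> Basis" for b
    using Suc that fg
    by (subst Ck_on_cong[where g="\<lambda>x. partial_deriv b f x * g x + f x * partial_deriv b g x"])
      (auto simp: partial_deriv_mult intro!: Ck_on_add)
  then show ?case using Suc.prems by auto
qed (auto intro: continuous_on_mult)

lemma Ck_on_cmult: "open S \<Longrightarrow> Ck_on k S f \<Longrightarrow> Ck_on k S (\<lambda>x. c * f x)"
  by (rule Ck_on_mult[OF _ Ck_on_const])

text \<open>The iterated partial derivative along a list of basis vectors, the head being applied last. Lists
  instead of multi-indices make induction on the order direct; the numbers of occurrences of the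
  entries recover the multi-index.\<close>

definition iter_deriv :: "'a::euclidean_space list \<Rightarrow> ('a \<Rightarrow> complex) \<Rightarrow> 'a \<Rightarrow> complex"
  where "iter_deriv bs f = foldr partial_deriv bs f"

lemma iter_deriv_Nil [simp]: "iter_deriv [] f = f"
  and iter_deriv_Cons [simp]: "iter_deriv (b # bs) f = partial_deriv b (iter_deriv bs f)"
  and iter_deriv_append: "iter_deriv (bs @ cs) f = iter_deriv bs (iter_deriv cs f)"
  by (simp_all add: iter_deriv_def)

lemma Ck_on_iter_deriv:
  "Ck_on (k + length bs) S f \<Longrightarrow> set bs \<subseteq> Basis \<Longrightarrow> Ck_on k S (iter_deriv bs f)"
proof (induction bs arbitrary: k)
  case (Cons b bs)
  have "Ck_on (Suc k) S (iter_deriv bs f)" using Cons.IH[of "Suc k"] Cons.prems by simp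
  then show ?case using Cons.prems by simp
qed auto

lemma iter_deriv_cong:
  assumes "open S" "\<And>y. y \<in> S \<Longrightarrow> f y = g y" "x \<in> S"
  shows "iter_deriv bs f x = iter_deriv bs g x"
  using assms(3)
proof (induction bs arbitrary: x)
  case (Cons b bs)
  then show ?case by (auto intro: partial_deriv_cong[OF assms(1)])
qed (use assms in auto)

lemma iter_deriv_add:
  assumes "open S" "Ck_on (length bs) S f" "Ck_on (length bs) S g" "set bs \<subseteq> Basis" "x \<in> S"
  shows "iter_deriv bs (\<lambda>x. f x + g x) x = iter_deriv bs f x + iter_deriv bs g x"
  using assms(2-)
proof (induction bs arbitrary: x)
  case (Cons b bs)
  have "Ck_on (length bs) S f" "Ck_on (length bs) S g" 
    using Cons.prems by (auto intro: Ck_on_Suc_imp[of "length bs"] simp del: Ck_on.simps)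
  then have "iter_deriv (b # bs) (\<lambda>x. f x + g x) x
      = partial_deriv b (\<lambda>x. iter_deriv bs f x + iter_deriv bs g x) x"
    using Cons by (auto intro!: partial_deriv_cong[OF assms(1)])
  also have "\<dots> = iter_deriv (b # bs) f x + iter_deriv (b # bs) g x"
    using Ck_on_iter_deriv[of "Suc 0" bs S] Cons.prems by (auto intro!: partial_deriv_add simp del: Ck_on.simps(1))
  finally show ?case .
qed auto

lemma iter_deriv_cmult:
  assumes "open S" "Ck_on (length bs) S f" "set bs \<subseteq> Basis" "x \<in> S"
  shows "iter_deriv bs (\<lambda>x. c * f x) x = c * iter_deriv bs f x"
  using assms(2-)
proof (induction bs arbitrary: x)
  case (Cons b bs)
  have "Ck_on (length bs) S f"
    using Cons.prems by (auto intro: Ck_on_Suc_imp[of "length bs"] simp del: Ck_on.simps)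
  then have "iter_deriv (b # bs) (\<lambda>x. c * f x) x = partial_deriv b (\<lambda>x. c * iter_deriv bs f x) x"
    using Cons by (auto intro!: partial_deriv_cong[OF assms(1)])
  also have "\<dots> = c * iter_deriv (b # bs) f x"
    using Ck_on_iter_deriv[of "Suc 0" bs S] Cons.prems
    by (subst partial_deriv_mult) (auto simp del: Ck_on.simps(1))
  finally show ?case .
qed auto

text \<open>A directional derivative is the corresponding combination of partial derivatives.\<close>

lemma has_vector_derivative_line:
  assumes "f differentiable (at (x + t *\<^sub>R w))"
  shows "((\<lambda>t. f (x + t *\<^sub>R w)) has_vector_derivative
           (\<Sum>b\<in>Basis. of_real (w \<bullet> b) * partial_deriv b f (x + t *\<^sub>R w))) (at t)"
proof -
  let ?D = "frechet_derivative f (at (x + t *\<^sub>R w))"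
  have D: "(f has_derivative ?D) (at (x + t *\<^sub>R w))" using assms frechet_derivative_works by blast
  have lin: "linear ?D" using D has_derivative_linear by blast
  have "((\<lambda>t. f (x + t *\<^sub>R w)) has_derivative (\<lambda>h. ?D (h *\<^sub>R w))) (at t)"
    by (rule has_derivative_compose[where g=f and f="\<lambda>t. x + t *\<^sub>R w", OF _ D]) (auto intro!: derivative_eq_intros)
  moreover have "?D (h *\<^sub>R w) = h *\<^sub>R (\<Sum>b\<in>Basis. of_real (w \<bullet> b) * partial_deriv b f (x + t *\<^sub>R w))" for h
  proof -
    have "?D w = ?D (\<Sum>b\<in>Basis. (w \<bullet> b) *\<^sub>R b)" by (simp add: euclidean_representation)
    also have "\<dots> = (\<Sum>b\<in>Basis. (w \<bullet> b) *\<^sub>R ?D b)"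
      by (simp add: linear_sum[OF lin] linear_cmul[OF lin])
    finally show ?thesis by (simp add: linear_cmul[OF lin] partial_deriv_def scaleR_conv_of_real)
  qed
  ultimately show ?thesis unfolding has_vector_derivative_def by simp
qed

lemma has_vector_derivative_line_Basis:
  assumes "f differentiable (at (x + t *\<^sub>R b))" "b \<in> Basis"
  shows "((\<lambda>t. f (x + t *\<^sub>R b)) has_vector_derivative partial_deriv b f (x + t *\<^sub>R b)) (at t)"
proof -
  have "(\<Sum>i\<in>Basis. of_real (b \<bullet> i) * partial_deriv i f (x + t *\<^sub>R b)) = partial_deriv b f (x + t *\<^sub>R b)"
    using assms(2) by (simp add: inner_Basis if_distrib[of of_real] if_distrib[of "\<lambda>u. u * _"] cong: if_cong)
  then show ?thesis using has_vector_derivative_line[OF assms(1)] by simp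
qed

lemma norm_diff_le_of_vector_derivative:
  fixes F :: "real \<Rightarrow> complex"
  assumes "0 < h" "\<And>t. 0 \<le> t \<Longrightarrow> t \<le> h \<Longrightarrow> (F has_vector_derivative F' t) (at t)"
    and "\<And>t. 0 \<le> t \<Longrightarrow> t \<le> h \<Longrightarrow> norm (F' t) \<le> B"
  shows "norm (F h - F 0) \<le> B * h"
proof -
  have "continuous_on {0..h} F"
    by (rule continuous_at_imp_continuous_on) (metis assms(2) atLeastAtMost_iff has_vector_derivative_continuous)
  then obtain t where "t \<in> {0<..<h}" "norm (F h - F 0) \<le> norm (h *\<^sub>R F' t)"
    using mvt_general[OF assms(1), where f=F and f'="\<lambda>t u. u *\<^sub>R F' t"] assms(1,2)
    unfolding has_vector_derivative_def by force
  then show ?thesis using assms(1) assms(3)[of t] by (auto simp: mult.commute intro: order_trans)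
qed

text \<open>Two applications of the mean value inequality: the second difference of \<open>f\<close>, divided by \<open>h\<^sup>2\<close>,
  approximates the mixed derivative. Since the second difference is symmetric in the two directions,
  mixed derivatives of \<open>C\<^sup>2\<close> functions agree.\<close>

lemma second_difference_estimate:
  assumes ab: "a \<in> Basis" "b \<in> Basis" and h: "0 < h"
    and f: "\<And>y. y \<in> ball x r \<Longrightarrow> f differentiable (at y)"
    and fa: "\<And>y. y \<in> ball x r \<Longrightarrow> partial_deriv a f differentiable (at y)"
    and hr: "2 * h < r"
    and e: "\<And>y. y \<in> ball x r \<Longrightarrow> norm (partial_deriv b (partial_deriv a f) y - c) \<le> e"
  shows "norm (f (x + h *\<^sub>R a + h *\<^sub>R b) - f (x + h *\<^sub>R a) - f (x + h *\<^sub>R b) + f x - of_real (h\<^sup>2) * c) \<le> e * h\<^sup>2"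
proof -
  have ball: "x + s *\<^sub>R a + t *\<^sub>R b \<in> ball x r" if "0 \<le> s" "s \<le> h" "0 \<le> t" "t \<le> h" for s t
  proof -
    have "norm (s *\<^sub>R a + t *\<^sub>R b) \<le> s + t"
      using norm_triangle_ineq[of "s *\<^sub>R a" "t *\<^sub>R b"] ab that by simp
    moreover have "dist x (x + s *\<^sub>R a + t *\<^sub>R b) = norm (s *\<^sub>R a + t *\<^sub>R b)"
      by (metis add.assoc add_diff_cancel_left' dist_commute dist_norm)
    ultimately show ?thesis using that hr by simp
  qed
  have ball0: "x + s *\<^sub>R a \<in> ball x r" if "0 \<le> s" "s \<le> h" for s
    using ball[of s 0] that h by simp
  define F where "F s = f (x + h *\<^sub>R b + s *\<^sub>R a) - f (x + s *\<^sub>R a) - of_real s * (of_real h * c)" for s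
  define F' where "F' s = partial_deriv a f (x + h *\<^sub>R b + s *\<^sub>R a) - partial_deriv a f (x + s *\<^sub>R a) - of_real h * c" for s
  have dF: "(F has_vector_derivative F' s) (at s)" if "0 \<le> s" "s \<le> h" for s
  proof -
    have "x + h *\<^sub>R b + s *\<^sub>R a \<in> ball x r"
      using ball[OF that, of h] h by (simp add: add.assoc add.commute[of "h *\<^sub>R b"])
    then show ?thesis
      unfolding F_def F'_def using ball0[OF that]
      by (auto intro!: derivative_eq_intros has_vector_derivative_line_Basis f ab)
  qed
  have bF: "norm (F' s) \<le> e * h" if s: "0 \<le> s" "s \<le> h" for s
  proof -
    define G where "G t = partial_deriv a f (x + s *\<^sub>R a + t *\<^sub>R b) - of_real t * c" for t
    have "(G has_vector_derivative (partial_deriv b (partial_deriv a f) (x + s *\<^sub>R a + t *\<^sub>R b) - c)) (at t)"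
      if "0 \<le> t" "t \<le> h" for t
      unfolding G_def using ball[OF s that]
      by (auto intro!: derivative_eq_intros has_vector_derivative_line_Basis fa ab)
    then have "norm (G h - G 0) \<le> e * h"
      by (rule norm_diff_le_of_vector_derivative[OF h]) (use e ball[OF s] in auto)
    then show ?thesis by (simp add: G_def F'_def algebra_simps)
  qed
  have "norm (F h - F 0) \<le> (e * h) * h"
    by (rule norm_diff_le_of_vector_derivative[OF h dF bF])
  then show ?thesis by (simp add: F_def algebra_simps power2_eq_square)
qed

lemma partial_deriv_commute:
  assumes "open S" "Ck_on 2 S f" "x \<in> S" "a \<in> Basis" "b \<in> Basis"
  shows "partial_deriv a (partial_deriv b f) x = partial_deriv b (partial_deriv a f) x"
proof -
  let ?A = "partial_deriv b (partial_deriv a f)" and ?B = "partial_deriv a (partial_deriv b f)"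
  have C: "Ck_on 0 S ?A" "Ck_on 0 S ?B" and f: "\<And>y. y \<in> S \<Longrightarrow> f differentiable (at y)"
    and fa: "\<And>y. y \<in> S \<Longrightarrow> partial_deriv a f differentiable (at y)"
    and fb: "\<And>y. y \<in> S \<Longrightarrow> partial_deriv b f differentiable (at y)"
    using assms(2,4,5) by (auto simp: numeral_2_eq_2)
  have "norm (?A x - ?B x) \<le> 0"
  proof (rule field_le_epsilon)
    fix e :: real assume "e > 0"
    then have e2: "e / 2 > 0" by simp
    have lim: "isCont ?A x" "isCont ?B x"
      using C assms(1,3) by (auto simp: continuous_on_eq_continuous_at)
    obtain r1 where r1: "r1 > 0" "\<And>y. dist y x < r1 \<Longrightarrow> dist (?A y) (?A x) < e/2"
      using lim(1) e2 unfolding continuous_at_eps_delta by blast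
    obtain r2 where r2: "r2 > 0" "\<And>y. dist y x < r2 \<Longrightarrow> dist (?B y) (?B x) < e/2"
      using lim(2) e2 unfolding continuous_at_eps_delta by blast
    obtain r3 where r3: "r3 > 0" "ball x r3 \<subseteq> S" using assms(1,3) openE by blast
    define r where "r = min r1 (min r2 r3)"
    define h where "h = r / 3"
    have h: "h > 0" "2 * h < r" using r1 r2 r3 by (auto simp: h_def r_def)
    have S: "y \<in> S" if "y \<in> ball x r" for y using that r3 by (auto simp: r_def)
    let ?D = "f (x + h *\<^sub>R a + h *\<^sub>R b) - f (x + h *\<^sub>R a) - f (x + h *\<^sub>R b) + f x"
    have 1: "norm (?D - of_real (h\<^sup>2) * ?A x) \<le> e/2 * h\<^sup>2"
      using S r1(2) by (intro second_difference_estimate[OF assms(4,5) h(1) _ _ h(2)])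
        (auto simp: r_def dist_commute intro: f fa simp flip: dist_norm intro: less_imp_le)
    have "norm (f (x + h *\<^sub>R b + h *\<^sub>R a) - f (x + h *\<^sub>R b) - f (x + h *\<^sub>R a) + f x - of_real (h\<^sup>2) * ?B x) \<le> e/2 * h\<^sup>2"
      using S r2(2) by (intro second_difference_estimate[OF assms(5,4) h(1) _ _ h(2)])
        (auto simp: r_def dist_commute intro: f fb simp flip: dist_norm intro: less_imp_le)
    then have 2: "norm (?D - of_real (h\<^sup>2) * ?B x) \<le> e/2 * h\<^sup>2"
      by (simp add: algebra_simps)
    have "norm (of_real (h\<^sup>2) * (?A x - ?B x)) \<le> e * h\<^sup>2"
      using norm_triangle_le_diff[of "?D - of_real (h\<^sup>2) * ?B x" "?D - of_real (h\<^sup>2) * ?A x" "e * h\<^sup>2"] 1 2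
      by (simp add: algebra_simps)
    then have "h\<^sup>2 * norm (?A x - ?B x) \<le> h\<^sup>2 * e" by (simp add: norm_mult norm_power mult.commute)
    then show "norm (?A x - ?B x) \<le> 0 + e" using h by simp
  qed
  then show ?thesis by simp
qed

lemma iter_deriv_move:
  assumes "open S" "Ck_on (Suc (length (cs @ ds))) S f" "set (b # cs @ ds) \<subseteq> Basis" "x \<in> S"
  shows "iter_deriv (cs @ b # ds) f x = iter_deriv (b # cs @ ds) f x"
  using assms(2-)
proof (induction cs arbitrary: x)
  case (Cons c cs)
  have C: "Ck_on (Suc (length (cs @ ds))) S f"
    using Cons.prems(1) Ck_on_mono by (metis append_Cons le_Suc_eq length_Cons nat_le_linear)
  have "iter_deriv ((c # cs) @ b # ds) f x = partial_deriv c (iter_deriv (b # cs @ ds) f) x"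
    using Cons.prems Cons.IH[OF C] by (simp, intro partial_deriv_cong[OF assms(1)]) auto
  also have "\<dots> = partial_deriv b (partial_deriv c (iter_deriv (cs @ ds) f)) x"
    using Cons.prems unfolding iter_deriv_Cons
    by (intro partial_deriv_commute[OF assms(1)] Ck_on_iter_deriv) (simp_all del: Ck_on.simps add: numeral_2_eq_2)
  finally show ?case by simp
qed auto

lemma iter_deriv_mset:
  assumes "open S" "Ck_on (length bs) S f" "set bs \<subseteq> Basis" "x \<in> S" "mset bs = mset cs"
  shows "iter_deriv bs f x = iter_deriv cs f x"
  using assms(2-)
proof (induction bs arbitrary: cs x)
  case (Cons b bs)
  have "b \<in> set cs" using Cons.prems by (metis list.set_intros(1) mset_eq_setD)
  then obtain us vs where cs: "cs = us @ b # vs" by (meson split_list)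
  have m: "mset bs = mset (us @ vs)" using Cons.prems cs by simp
  have C: "Ck_on (length bs) S f" using Cons.prems(1) by (auto intro: Ck_on_Suc_imp simp del: Ck_on.simps)
  have "iter_deriv (b # bs) f x = iter_deriv (b # us @ vs) f x"
    using Cons.IH[OF C _ _ m] Cons.prems by (simp, intro partial_deriv_cong[OF assms(1)]) auto
  also have "\<dots> = iter_deriv cs f x"
    using Cons.prems mset_eq_length[OF m] mset_eq_setD[OF m] unfolding cs
    by (intro iter_deriv_move[OF assms(1), symmetric]) (auto simp del: Ck_on.simps)
  finally show ?case .
qed auto

text \<open>The list that contains each direction \<open>b\<close> exactly \<open>m b\<close> times, in the order of the fixed enumeration.\<close>

definition mi_list :: "('a::euclidean_space \<Rightarrow> nat) \<Rightarrow> 'a list"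
  where "mi_list m = concat (map (\<lambda>b. replicate (m b) b) basis_enum)"

lemma foldr_partial_deriv_replicate:
  "(partial_deriv b ^^ n) g = iter_deriv (replicate n b) g"
  by (induction n) auto

lemma mi_deriv_eq: "mi_deriv m f = iter_deriv (mi_list m) f"
proof -
  have "foldr (\<lambda>b g. (partial_deriv b ^^ m b) g) cs f = iter_deriv (concat (map (\<lambda>b. replicate (m b) b) cs)) f" for cs
    by (induction cs) (auto simp: foldr_partial_deriv_replicate iter_deriv_append)
  then show ?thesis by (simp add: mi_deriv_def mi_list_def)
qed

lemma set_mi_list: "set (mi_list m) \<subseteq> Basis"
  by (auto simp: mi_list_def basis_enum)

lemma length_mi_list: "length (mi_list m) = order_mi m"
proof -
  have "sum_list (map m basis_enum) = (\<Sum>b\<in>Basis. m b)"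
    using basis_enum by (metis sum_list_distinct_conv_sum_set)
  then show ?thesis by (simp add: mi_list_def order_mi_def length_concat o_def)
qed

lemma count_mi_list: "b \<in> Basis \<Longrightarrow> count_list (mi_list m) b = m b"
proof -
  assume b: "b \<in> Basis"
  have rep: "count_list (replicate n a) b = (if a = b then n else 0)" for n a
    by (induction n) auto
  have "count_list (concat (map (\<lambda>b. replicate (m b) b) cs)) b = (if b \<in> set cs then m b else 0)"
    if "distinct cs" for cs
    using that by (induction cs) (auto simp: rep)
  from this[OF basis_enum(1)] show ?thesis using b by (simp add: mi_list_def basis_enum(2))
qed

lemma count_list_multi_index:
  assumes "set bs \<subseteq> Basis"
  shows "count_list bs \<in> multi_indices" "order_mi (count_list bs) = length bs"
    "mset (mi_list (count_list bs)) = mset bs"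
proof -
  show "count_list bs \<in> multi_indices" using assms by (auto simp: multi_indices_def count_list_0_iff)
  show "order_mi (count_list bs) = length bs"
    using assms unfolding order_mi_def by (intro sum_count_set) auto
  show "mset (mi_list (count_list bs)) = mset bs"
  proof (rule multiset_eqI)
    fix b
    show "count (mset (mi_list (count_list bs))) b = count (mset bs) b"
    proof (cases "b \<in> Basis")
      case True
      then show ?thesis using count_mi_list by (metis count_mset)
    next
      case False
      then have "b \<notin> set (mi_list (count_list bs))" "b \<notin> set bs" using set_mi_list assms by auto
      then show ?thesis by (metis not_in_iff set_mset_mset)
    qed
  qed
qed

text \<open>As the order of differentiation is immaterial, bounds on the derivatives \<open>\<partial>\<^sup>m f\<close> control the derivatives
  along every list.\<close>

lemma iter_deriv_eq_mi_deriv: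
  assumes "open S" "Ck_on (length bs) S f" "set bs \<subseteq> Basis" "x \<in> S"
  shows "iter_deriv bs f x = mi_deriv (count_list bs) f x"
  unfolding mi_deriv_eq
  by (rule iter_deriv_mset[OF assms]) (simp add: count_list_multi_index(3)[OF assms(3)])

lemma finite_multi_indices: "finite {m :: 'a::euclidean_space \<Rightarrow> nat. m \<in> multi_indices \<and> order_mi m \<le> N}"
proof -
  have "{m :: 'a \<Rightarrow> nat. m \<in> multi_indices \<and> order_mi m \<le> N} \<subseteq>
      (\<lambda>g b. if b \<in> Basis then g b else 0) ` (Basis \<rightarrow>\<^sub>E {..N})"
  proof
    fix m :: "'a \<Rightarrow> nat" assume m: "m \<in> {m. m \<in> multi_indices \<and> order_mi m \<le> N}"
    have "m b \<le> N" if "b \<in> Basis" for b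
      using member_le_sum[of b Basis m] m that by (auto simp: order_mi_def)
    then have "restrict m Basis \<in> Basis \<rightarrow>\<^sub>E {..N}" by auto
    moreover have "m = (\<lambda>b. if b \<in> Basis then restrict m Basis b else 0)"
      using m by (auto simp: multi_indices_def)
    ultimately show "m \<in> (\<lambda>g b. if b \<in> Basis then g b else 0) ` (Basis \<rightarrow>\<^sub>E {..N})" by blast
  qed
  moreover have "finite ((\<lambda>g (b::'a). if b \<in> Basis then g b else 0) ` (Basis \<rightarrow>\<^sub>E {..N}))"
    by (intro finite_imageI finite_PiE) auto
  ultimately show ?thesis by (rule finite_subset)
qed

section \<open>Bounds on derivatives and the space of test functions\<close>

text \<open>All partial derivatives of \<open>f\<close> of order at most \<open>k\<close> are bounded by \<open>M\<close> on \<open>S\<close>. This relation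
  replaces the \<open>C\<^sup>k\<close> seminorms: it says that the seminorm is at most \<open>M\<close>, without a supremum and its
  boundedness conditions.\<close>

definition derivs_le :: "nat \<Rightarrow> 'a::euclidean_space set \<Rightarrow> ('a \<Rightarrow> complex) \<Rightarrow> real \<Rightarrow> bool"
  where "derivs_le k S f M \<longleftrightarrow>
    (\<forall>bs. set bs \<subseteq> Basis \<and> length bs \<le> k \<longrightarrow> (\<forall>x\<in>S. norm (iter_deriv bs f x) \<le> M))"

lemma derivs_leD:
  "derivs_le k S f M \<Longrightarrow> set bs \<subseteq> Basis \<Longrightarrow> length bs \<le> k \<Longrightarrow> x \<in> S \<Longrightarrow>
    norm (iter_deriv bs f x) \<le> M"
  by (auto simp: derivs_le_def)

lemma derivs_leI:
  "(\<And>bs x. set bs \<subseteq> Basis \<Longrightarrow> length bs \<le> k \<Longrightarrow> x \<in> S \<Longrightarrow> norm (iter_deriv bs f x) \<le> M) \<Longrightarrow>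
    derivs_le k S f M"
  by (auto simp: derivs_le_def)

lemma derivs_le_mono: "derivs_le k S f M \<Longrightarrow> l \<le> k \<Longrightarrow> M \<le> M' \<Longrightarrow> derivs_le l S f M'"
  unfolding derivs_le_def by (meson order_trans)

lemma derivs_le_norm: "derivs_le k S f M \<Longrightarrow> x \<in> S \<Longrightarrow> norm (f x) \<le> M"
  using derivs_leD[of k S f M "[]" x] by simp

lemma derivs_le_nonneg: "derivs_le k S f M \<Longrightarrow> x \<in> S \<Longrightarrow> 0 \<le> M"
  using derivs_le_norm norm_ge_zero order_trans by blast

lemma derivs_le_subset: "derivs_le k S f M \<Longrightarrow> U \<subseteq> S \<Longrightarrow> derivs_le k U f M"
  unfolding derivs_le_def by blast

lemma derivs_le_Un: "derivs_le k S f M \<Longrightarrow> derivs_le k U f M \<Longrightarrow> derivs_le k (S \<union> U) f M"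
  unfolding derivs_le_def by blast

lemma derivs_le_cmult:
  fixes f :: "'a::euclidean_space \<Rightarrow> complex"
  assumes "open S" "Ck_on k S f" "derivs_le k S f M"
  shows "derivs_le k S (\<lambda>x. c * f x) (norm c * M)"
proof (rule derivs_leI)
  fix bs :: "'a list" and x assume bs: "set bs \<subseteq> Basis" "length bs \<le> k" "x \<in> S"
  then have "iter_deriv bs (\<lambda>x. c * f x) x = c * iter_deriv bs f x"
    using assms by (intro iter_deriv_cmult) (auto intro: Ck_on_mono)
  then show "norm (iter_deriv bs (\<lambda>x. c * f x) x) \<le> norm c * M"
    using derivs_leD[OF assms(3) bs] by (simp add: norm_mult mult_left_mono)
qed

text \<open>A form of the Leibniz rule: each derivative of a product doubles the number of terms, whence the
  factor \<open>2\<^sup>k\<close>. The functions are regular on the open set \<open>S\<close>, while the bounds may hold on a smaller set.\<close>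

lemma derivs_le_mult:
  fixes f g :: "'a::euclidean_space \<Rightarrow> complex"
  assumes "open S" "U \<subseteq> S" "Ck_on k S f" "Ck_on k S g" "derivs_le k U f A" "derivs_le k U g B"
  shows "derivs_le k U (\<lambda>x. f x * g x) (2 ^ k * A * B)"
  using assms(3-)
proof (induction k arbitrary: f g)
  case 0
  then show ?case
    by (auto simp: derivs_le_def norm_mult intro!: mult_mono elim: order_trans[OF norm_ge_zero])
next
  case (Suc k)
  have fg: "Ck_on k S f" "Ck_on k S g" using Suc.prems Ck_on_Suc_imp by blast+
  show ?case
  proof (rule derivs_leI)
    fix bs :: "'a list" and x assume bs: "set bs \<subseteq> Basis" "length bs \<le> Suc k" "x \<in> U"
    have xS: "x \<in> S" using bs assms(2) by blast
    have AB: "0 \<le> A" "0 \<le> B" using derivs_le_nonneg Suc.prems bs by blast+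
    show "norm (iter_deriv bs (\<lambda>x. f x * g x) x) \<le> 2 ^ Suc k * A * B"
    proof (cases bs rule: rev_cases)
      case Nil
      have "norm (f x) * norm (g x) \<le> A * B"
        using Suc.prems bs(3) AB by (intro mult_mono derivs_le_norm) auto
      also have "\<dots> \<le> 2 ^ Suc k * (A * B)"
        using AB mult_right_mono[OF one_le_power[of "2::real" "Suc k"], of "A * B"] by simp
      finally show ?thesis using Nil by (simp add: norm_mult mult.assoc)
    next
      case (snoc cs b)
      have b: "b \<in> Basis" "set cs \<subseteq> Basis" "length cs \<le> k" using bs snoc by auto
      have part: "derivs_le k U (partial_deriv b h) M" if "derivs_le (Suc k) U h M" for h M
        using derivs_leD[OF that, of "_ @ [b]"] b(1) by (intro derivs_leI) (simp add: iter_deriv_append)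
      have lower: "derivs_le k U h M" if "derivs_le (Suc k) U h M" for h M
        using that by (rule derivs_le_mono) auto
      have C: "Ck_on k S (partial_deriv b f)" "Ck_on k S (partial_deriv b g)"
        using Suc.prems b by auto
      have le: "norm (iter_deriv cs (\<lambda>x. partial_deriv b f x * g x) x) \<le> 2 ^ k * A * B"
        "norm (iter_deriv cs (\<lambda>x. f x * partial_deriv b g x) x) \<le> 2 ^ k * A * B"
        using derivs_leD[OF Suc.IH[OF C(1) fg(2) part[OF Suc.prems(3)] lower[OF Suc.prems(4)]] b(2,3) bs(3)]
          derivs_leD[OF Suc.IH[OF fg(1) C(2) lower[OF Suc.prems(3)] part[OF Suc.prems(4)]] b(2,3) bs(3)]
        by auto
      have "iter_deriv bs (\<lambda>x. f x * g x) x
          = iter_deriv cs (\<lambda>x. partial_deriv b f x * g x + f x * partial_deriv b g x) x"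
        unfolding snoc iter_deriv_append using Suc.prems xS
        by (auto intro!: iter_deriv_cong[OF assms(1)] partial_deriv_mult)
      also have "\<dots> = iter_deriv cs (\<lambda>x. partial_deriv b f x * g x) x + iter_deriv cs (\<lambda>x. f x * partial_deriv b g x) x"
        using C fg b xS assms(1)
        by (intro iter_deriv_add) (auto intro!: Ck_on_mult intro: Ck_on_mono)
      finally show ?thesis using norm_triangle_mono[OF le] by (simp add: mult_ac)
    qed
  qed
qed

text \<open>The space of smooth functions that vanish off \<open>K\<close>, with the seminorms described by \<open>derivs_le\<close>.\<close>

definition test_in :: "'a::euclidean_space set \<Rightarrow> ('a \<Rightarrow> complex) set"
  where "test_in K = {\<phi>. smooth_on UNIV \<phi> \<and> (\<forall>x. x \<notin> K \<longrightarrow> \<phi> x = 0)}"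

lemma smooth_onD: "smooth_on S \<phi> \<Longrightarrow> Ck_on k S \<phi>"
  by (simp add: smooth_on_def)

lemma test_inD: "\<phi> \<in> test_in K \<Longrightarrow> smooth_on UNIV \<phi>" "\<phi> \<in> test_in K \<Longrightarrow> Ck_on k UNIV \<phi>"
  "\<phi> \<in> test_in K \<Longrightarrow> x \<notin> K \<Longrightarrow> \<phi> x = 0"
  by (auto simp: test_in_def smooth_on_def)

lemma test_in_add: "\<phi> \<in> test_in K \<Longrightarrow> \<psi> \<in> test_in K \<Longrightarrow> (\<lambda>x. \<phi> x + \<psi> x) \<in> test_in K"
  by (auto simp: test_in_def smooth_on_def intro: Ck_on_add)

lemma test_in_cmult: "\<phi> \<in> test_in K \<Longrightarrow> (\<lambda>x. c * \<phi> x) \<in> test_in K"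
  by (auto simp: test_in_def smooth_on_def intro: Ck_on_cmult)

lemma zero_in_test_in: "(\<lambda>x. 0) \<in> test_in K"
  by (auto simp: test_in_def smooth_on_def intro: Ck_on_const)

lemma test_in_mult_smooth:
  "\<rho> \<in> test_in K \<Longrightarrow> smooth_on UNIV \<phi> \<Longrightarrow> (\<lambda>x. \<rho> x * \<phi> x) \<in> test_in K"
  by (auto simp: test_in_def smooth_on_def intro: Ck_on_mult)

lemma supp_subset: "closed K \<Longrightarrow> (\<And>x. x \<notin> K \<Longrightarrow> \<phi> x = 0) \<Longrightarrow> supp \<phi> \<subseteq> K"
  unfolding supp_def by (intro closure_minimal) auto

lemma test_in_supp: "compact K \<Longrightarrow> \<phi> \<in> test_in K \<Longrightarrow> supp \<phi> \<subseteq> K"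
  by (intro supp_subset compact_imp_closed) (auto simp: test_in_def)

lemma test_in_subset:
  assumes "compact K" "K \<subseteq> \<Omega>"
  shows "test_in K \<subseteq> test_functions \<Omega>"
proof
  fix \<phi> :: "'a \<Rightarrow> complex" assume \<phi>: "\<phi> \<in> test_in K"
  have "compact (supp \<phi>)"
    using test_in_supp[OF assms(1) \<phi>] assms(1)
    by (metis closed_closure compact_Int_closed inf.absorb2 supp_def)
  then show "\<phi> \<in> test_functions \<Omega>"
    using test_in_supp[OF assms(1) \<phi>] assms(2) \<phi> by (auto simp: test_functions_def test_in_def)
qed

lemma test_functions_in: "\<rho> \<in> test_functions \<Omega> \<Longrightarrow> \<rho> \<in> test_in (supp \<rho>)"
  using closure_subset by (force simp: test_functions_def test_in_def supp_def)

lemma derivs_le_of_mi_deriv: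
  fixes f :: "'a::euclidean_space \<Rightarrow> complex"
  assumes "open S" "Ck_on k S f" "U \<subseteq> S"
    and "\<And>m x. m \<in> multi_indices \<Longrightarrow> order_mi m \<le> k \<Longrightarrow> x \<in> U \<Longrightarrow> norm (mi_deriv m f x) \<le> M"
  shows "derivs_le k U f M"
proof (rule derivs_leI)
  fix bs :: "'a list" and x assume bs: "set bs \<subseteq> Basis" "length bs \<le> k" "x \<in> U"
  have "iter_deriv bs f x = mi_deriv (count_list bs) f x"
    using assms bs by (intro iter_deriv_eq_mi_deriv[OF assms(1)] Ck_on_mono[OF assms(2)]) auto
  then show "norm (iter_deriv bs f x) \<le> M"
    using assms(4)[of "count_list bs" x] count_list_multi_index[OF bs(1)] bs by simp
qed

lemma norm_mi_deriv_le:
  "derivs_le k S f M \<Longrightarrow> order_mi m \<le> k \<Longrightarrow> x \<in> S \<Longrightarrow> norm (mi_deriv m f x) \<le> M"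
  unfolding mi_deriv_eq by (intro derivs_leD) (auto simp: set_mi_list[THEN subsetD] length_mi_list)

lemma derivs_le_compact:
  fixes f :: "'a::euclidean_space \<Rightarrow> complex"
  assumes "compact K" "K \<subseteq> S" "Ck_on k S f"
  shows "\<exists>M. derivs_le k K f M"
proof -
  let ?L = "{bs. set bs \<subseteq> (Basis :: 'a set) \<and> length bs \<le> k}"
  have "\<forall>bs\<in>?L. \<exists>B. \<forall>x\<in>K. norm (iter_deriv bs f x) \<le> B"
  proof
    fix bs :: "'a list" assume bs: "bs \<in> ?L"
    then have "Ck_on 0 S (iter_deriv bs f)"
      by (intro Ck_on_iter_deriv Ck_on_mono[OF assms(3)]) auto
    then have "compact (iter_deriv bs f ` K)"
      using assms(1,2) by (intro compact_continuous_image) (auto intro: continuous_on_subset)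
    then show "\<exists>B. \<forall>x\<in>K. norm (iter_deriv bs f x) \<le> B"
      using compact_imp_bounded bounded_iff by (metis imageI)
  qed
  then obtain B where B: "\<And>bs x. bs \<in> ?L \<Longrightarrow> x \<in> K \<Longrightarrow> norm (iter_deriv bs f x) \<le> B bs" by metis
  have "finite ?L" by (rule finite_lists_length_le) simp
  then have "norm (iter_deriv bs f x) \<le> (\<Sum>bs\<in>?L. \<bar>B bs\<bar>)" if "bs \<in> ?L" "x \<in> K" for bs x
    using B[OF that] member_le_sum[of bs ?L "\<lambda>bs. \<bar>B bs\<bar>"] that by fastforce
  then show ?thesis by (intro exI[of _ "\<Sum>bs\<in>?L. \<bar>B bs\<bar>"] derivs_leI) auto
qed

lemma derivs_le_outside:
  fixes f :: "'a::euclidean_space \<Rightarrow> complex"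
  assumes "open S" "\<And>x. x \<in> S \<Longrightarrow> f x = 0" "0 \<le> M"
  shows "derivs_le k S f M"
proof (rule derivs_leI)
  fix bs :: "'a list" and x assume "x \<in> S"
  then have "iter_deriv bs f x = iter_deriv bs (\<lambda>x. 0) x" by (intro iter_deriv_cong[OF assms(1,2)])
  also have "iter_deriv bs (\<lambda>x. 0) = (\<lambda>x. 0)" by (induction bs) auto
  finally show "norm (iter_deriv bs f x) \<le> M" using assms(3) by simp
qed

lemma test_in_derivs_le:
  assumes "compact K" "\<phi> \<in> test_in K"
  shows "\<exists>M. derivs_le k UNIV \<phi> M"
proof -
  obtain M where M: "derivs_le k K \<phi> M"
    using derivs_le_compact[OF assms(1) subset_UNIV test_inD(2)[OF assms(2)]] by blast
  have "derivs_le k (- K) \<phi> (max M 0)"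
    using assms compact_imp_closed test_inD(3) by (intro derivs_le_outside) auto
  then have "derivs_le k (K \<union> - K) \<phi> (max M 0)"
    using derivs_le_mono[OF M] by (intro derivs_le_Un) auto
  then show ?thesis by auto
qed

lemma affine_differentiable:
  assumes "f differentiable (at (a + c *\<^sub>R y))"
  shows "(\<lambda>y. f (a + c *\<^sub>R y)) differentiable (at y)"
    and "partial_deriv b (\<lambda>y. f (a + c *\<^sub>R y)) y = of_real c * partial_deriv b f (a + c *\<^sub>R y)"
proof -
  let ?D = "frechet_derivative f (at (a + c *\<^sub>R y))"
  have D: "(f has_derivative ?D) (at (a + c *\<^sub>R y))" using assms frechet_derivative_works by blast
  have lin: "linear ?D" using D has_derivative_linear by blast
  have E: "((\<lambda>y. f (a + c *\<^sub>R y)) has_derivative (\<lambda>h. ?D (c *\<^sub>R h))) (at y)"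
    by (rule has_derivative_compose[where g=f and f="\<lambda>y. a + c *\<^sub>R y", OF _ D]) (auto intro!: derivative_eq_intros)
  show "(\<lambda>y. f (a + c *\<^sub>R y)) differentiable (at y)" using E differentiable_def by blast
  show "partial_deriv b (\<lambda>y. f (a + c *\<^sub>R y)) y = of_real c * partial_deriv b f (a + c *\<^sub>R y)"
    using partial_deriv_eqI[OF E, of b] by (simp add: linear_cmul[OF lin] partial_deriv_def[of b f] scaleR_conv_of_real)
qed

lemma Ck_on_affine: "Ck_on k UNIV f \<Longrightarrow> Ck_on k UNIV (\<lambda>y. f (a + c *\<^sub>R y))"
proof (induction k arbitrary: f)
  case 0
  then show ?case by (auto intro!: continuous_on_compose2[of UNIV f] continuous_intros)
next
  case (Suc k)
  have "partial_deriv b (\<lambda>y. f (a + c *\<^sub>R y)) = (\<lambda>y. of_real c * partial_deriv b f (a + c *\<^sub>R y))" for b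
    using Suc.prems by (intro ext affine_differentiable(2)) auto
  then show ?case using Suc by (auto intro!: affine_differentiable(1) Ck_on_cmult)
qed

lemma derivs_le_affine:
  fixes f :: "'a::euclidean_space \<Rightarrow> complex"
  assumes "Ck_on k UNIV f" "derivs_le k UNIV f M" "1 \<le> \<bar>c :: real\<bar>"
  shows "derivs_le k UNIV (\<lambda>y. f (a + c *\<^sub>R y)) (\<bar>c\<bar> ^ k * M)"
proof (rule derivs_leI)
  fix bs :: "'a list" and x assume bs: "set bs \<subseteq> Basis" "length bs \<le> k"
  have eq: "iter_deriv bs (\<lambda>y. f (a + c *\<^sub>R y)) = (\<lambda>y. of_real c ^ length bs * iter_deriv bs f (a + c *\<^sub>R y))"
    using bs
  proof (induction bs)
    case (Cons b bs)
    let ?F = "iter_deriv bs f"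
    have C: "Ck_on (Suc 0) UNIV ?F"
      using Cons.prems by (intro Ck_on_iter_deriv Ck_on_mono[OF assms(1)]) auto
    have d: "?F differentiable (at y)" for y using C by auto
    have "partial_deriv b (\<lambda>y. of_real c ^ length bs * ?F (a + c *\<^sub>R y)) y
        = of_real c ^ length bs * (of_real c * partial_deriv b ?F (a + c *\<^sub>R y))" for y
      using affine_differentiable[OF d, where a=a and c=c and y=y] by (subst partial_deriv_mult) auto
    then show ?case using Cons by (auto simp: mult_ac)
  qed auto
  have "norm (iter_deriv bs (\<lambda>y. f (a + c *\<^sub>R y)) x) = \<bar>c\<bar> ^ length bs * norm (iter_deriv bs f (a + c *\<^sub>R x))"
    by (simp add: eq norm_mult norm_power)
  also have "\<dots> \<le> \<bar>c\<bar> ^ k * M"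
    using derivs_leD[OF assms(2) bs UNIV_I] bs assms(3) by (intro mult_mono power_increasing) auto
  finally show "norm (iter_deriv bs (\<lambda>y. f (a + c *\<^sub>R y)) x) \<le> \<bar>c\<bar> ^ k * M" .
qed

section \<open>Completeness and uniform boundedness\<close>

text \<open>The sequential completeness behind the uniform boundedness principle: a series of smooth functions
  whose terms are eventually dominated by \<open>2\<^sup>-\<^sup>i\<close>, in each order of differentiation, has a smooth sum and
  can be differentiated term by term.\<close>

lemma iter_deriv_series:
  fixes \<phi> :: "nat \<Rightarrow> 'a::euclidean_space \<Rightarrow> complex"
  assumes \<phi>: "\<And>i. smooth_on UNIV (\<phi> i)"
    and ev: "\<And>k. \<forall>\<^sub>F i in sequentially. derivs_le k UNIV (\<phi> i) ((1/2) ^ i)"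
  shows "smooth_on UNIV (\<lambda>x. \<Sum>i. \<phi> i x)"
    and "set bs \<subseteq> Basis \<Longrightarrow> summable (\<lambda>i. iter_deriv bs (\<phi> i) x)"
    and "set bs \<subseteq> Basis \<Longrightarrow> iter_deriv bs (\<lambda>x. \<Sum>i. \<phi> i x) x = (\<Sum>i. iter_deriv bs (\<phi> i) x)"
proof -
  let ?G = "\<lambda>bs x. \<Sum>i. iter_deriv bs (\<phi> i) x"
  have evb: "\<forall>\<^sub>F i in sequentially. \<forall>x\<in>UNIV. norm (iter_deriv bs (\<phi> i) x) \<le> (1/2) ^ i"
    if "set bs \<subseteq> Basis" for bs
    using ev[of "length bs"] by eventually_elim (use that in \<open>auto intro: derivs_leD\<close>)
  have geo: "summable (\<lambda>i. (1/2::real) ^ i)" by (simp add: summable_geometric)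
  have summ: "summable (\<lambda>i. iter_deriv bs (\<phi> i) x)" if "set bs \<subseteq> Basis" for bs x
    using evb[OF that] by (intro summable_comparison_test_ev[OF _ geo]) (auto elim: eventually_mono)
  have unif: "uniform_limit UNIV (\<lambda>n x. \<Sum>i<n. iter_deriv bs (\<phi> i) x) (?G bs) sequentially"
    if "set bs \<subseteq> Basis" for bs
    by (rule Weierstrass_m_test_ev[OF evb[OF that] geo])
  have der: "(?G bs has_derivative (\<lambda>h. \<Sum>b\<in>Basis. of_real (h \<bullet> b) * ?G (b # bs) x)) (at x)"
    if bs: "set bs \<subseteq> Basis" for bs x
  proof -
    define f' where "f' i x h = (\<Sum>b\<in>Basis. of_real (h \<bullet> b) * iter_deriv (b # bs) (\<phi> i) x)" for i x and h :: 'a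
    define g' where "g' x h = (\<Sum>b\<in>Basis. of_real (h \<bullet> b) * ?G (b # bs) x)" for x and h :: 'a
    have d: "(iter_deriv bs (\<phi> i) has_derivative f' i x) (at x within UNIV)" for i x
    proof -
      have "Ck_on (Suc 0) UNIV (iter_deriv bs (\<phi> i))"
        using Ck_on_iter_deriv[of "Suc 0" bs] bs smooth_onD[OF \<phi>] by blast
      then have D: "(iter_deriv bs (\<phi> i) has_derivative frechet_derivative (iter_deriv bs (\<phi> i)) (at x)) (at x)"
        using frechet_derivative_works by auto
      have lin: "linear (frechet_derivative (iter_deriv bs (\<phi> i)) (at x))"
        using D has_derivative_linear by blast
      have "frechet_derivative (iter_deriv bs (\<phi> i)) (at x) h = f' i x h" for h
      proof -
        have "frechet_derivative (iter_deriv bs (\<phi> i)) (at x) (\<Sum>b\<in>Basis. (h \<bullet> b) *\<^sub>R b) = f' i x h"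
          unfolding f'_def by (simp add: linear_sum[OF lin] linear_cmul[OF lin] partial_deriv_def scaleR_conv_of_real)
        then show ?thesis by (simp add: euclidean_representation)
      qed
      then show ?thesis using D by (metis ext)
    qed
    have e: "\<forall>\<^sub>F n in sequentially. \<forall>x\<in>UNIV. \<forall>h. norm (sum (\<lambda>i. f' i x h) {..<n} - g' x h) \<le> e * norm h"
      if "e > 0" for e
    proof -
      let ?e = "e / DIM('a)"
      have "\<forall>\<^sub>F n in sequentially. \<forall>b\<in>Basis. \<forall>x\<in>UNIV. dist (\<Sum>i<n. iter_deriv (b # bs) (\<phi> i) x) (?G (b # bs) x) < ?e"
        using that bs unif by (intro eventually_ball_finite finite_Basis) (use uniform_limitD[OF unif] in \<open>auto simp del: iter_deriv_Cons\<close>)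
      then show ?thesis
      proof eventually_elim
        case (elim n)
        show ?case
        proof (intro ballI allI)
          fix x h :: 'a
          have "norm (sum (\<lambda>i. f' i x h) {..<n} - g' x h)
            = norm (\<Sum>b\<in>Basis. of_real (h \<bullet> b) * ((\<Sum>i<n. iter_deriv (b # bs) (\<phi> i) x) - ?G (b # bs) x))"
            unfolding f'_def g'_def
            by (subst sum.swap) (simp add: sum_distrib_left sum_subtractf algebra_simps)
          also have "\<dots> \<le> (\<Sum>b\<in>(Basis::'a set). norm h * ?e)"
          proof (intro sum_norm_le)
            fix b :: 'a assume b: "b \<in> Basis"
            have "norm ((\<Sum>i<n. iter_deriv (b # bs) (\<phi> i) x) - ?G (b # bs) x) \<le> ?e"
              using elim b by (auto simp: dist_norm simp del: iter_deriv_Cons intro: less_imp_le)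
            then show "norm (of_real (h \<bullet> b) * ((\<Sum>i<n. iter_deriv (b # bs) (\<phi> i) x) - ?G (b # bs) x)) \<le> norm h * ?e"
              unfolding norm_mult using Basis_le_norm[OF b, of h] by (intro mult_mono) auto
          qed
          also have "\<dots> = e * norm h" by simp
          finally show "norm (sum (\<lambda>i. f' i x h) {..<n} - g' x h) \<le> e * norm h" .
        qed
      qed
    qed
    obtain g where g: "\<And>x. (\<lambda>n. iter_deriv bs (\<phi> n) x) sums g x" "\<And>x. (g has_derivative g' x) (at x)"
      using has_derivative_series[of UNIV "\<lambda>i. iter_deriv bs (\<phi> i)" f' g', OF _ d e]
        summable_sums[OF summ[OF bs]] by (metis UNIV_I convex_UNIV)
    have "g = ?G bs" using g(1) sums_unique by blast
    then show ?thesis using g(2) unfolding g'_def by auto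
  qed
  have pd: "partial_deriv b (?G bs) x = ?G (b # bs) x" if "set bs \<subseteq> Basis" "b \<in> Basis" for b bs x
    using partial_deriv_eqI[OF der[OF that(1)], of b x] that(2)
    by (simp add: inner_Basis if_distrib[of of_real] if_distrib[of "\<lambda>u. u * _"] cong: if_cong)
  have C: "Ck_on k UNIV (?G bs)" if "set bs \<subseteq> Basis" for k bs
    using that
  proof (induction k arbitrary: bs)
    case 0
    show ?case unfolding Ck_on.simps
      by (intro continuous_at_imp_continuous_on ballI has_derivative_continuous[OF der[OF 0]])
  next
    case (Suc k)
    have "partial_deriv b (?G bs) = ?G (b # bs)" if "b \<in> Basis" for b
      using pd[OF Suc.prems that] by blast
    moreover have "?G bs differentiable (at x)" for x
      using der[OF Suc.prems] unfolding differentiable_def by blast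
    ultimately show ?case using Suc.IH[of "_ # bs"] Suc.prems by auto
  qed
  show "smooth_on UNIV (\<lambda>x. \<Sum>i. \<phi> i x)" using C[of "[]"] by (auto simp: smooth_on_def)
  show "summable (\<lambda>i. iter_deriv bs (\<phi> i) x)" if "set bs \<subseteq> Basis" using summ[OF that] .
  have eq: "iter_deriv bs (?G []) = ?G bs" if "set bs \<subseteq> Basis" for bs
    using that
  proof (induction bs)
    case (Cons b bs)
    then have "iter_deriv bs (?G []) = ?G bs" by simp
    then show ?case using pd[of bs b] Cons.prems unfolding iter_deriv_Cons by (intro ext) auto
  qed auto
  show "iter_deriv bs (\<lambda>x. \<Sum>i. \<phi> i x) x = (\<Sum>i. iter_deriv bs (\<phi> i) x)" if "set bs \<subseteq> Basis"
    using fun_cong[OF eq[OF that], of x] by simp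
qed

text \<open>The uniform boundedness principle, by a gliding hump. If it fails, functions \<open>\<phi>\<^sub>i\<close> and indices \<open>n\<^sub>i\<close>
  are chosen recursively so that \<open>U n\<^sub>i\<close> has modulus greater than \<open>i + 1\<close> at the partial sum up to
  \<open>\<phi>\<^sub>i\<close>, while all later terms together change this value by at most \<open>1\<close>. The values of the \<open>U n\<^sub>i\<close>
  at the full sum are then unbounded.\<close>

lemma uniform_boundedness_test_in:
  fixes K :: "'a::euclidean_space set" and U :: "nat \<Rightarrow> ('a \<Rightarrow> complex) \<Rightarrow> complex"
  assumes lin: "\<And>n. linear_functional_on (test_in K) (U n)"
    and cont: "\<And>n. \<exists>C N. \<forall>\<phi>\<in>test_in K. \<forall>M. derivs_le N UNIV \<phi> M \<longrightarrow> norm (U n \<phi>) \<le> C * M"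
    and bdd: "\<And>\<phi>. \<phi> \<in> test_in K \<Longrightarrow> \<exists>B. \<forall>n. norm (U n \<phi>) \<le> B"
  shows "\<exists>C N. \<forall>n. \<forall>\<phi>\<in>test_in K. \<forall>M. derivs_le N UNIV \<phi> M \<longrightarrow> norm (U n \<phi>) \<le> C * M"
proof (rule ccontr)
  assume "\<not> ?thesis"
  then have neg: "\<And>C N. \<exists>n. \<exists>\<phi>\<in>test_in K. \<exists>M. derivs_le N UNIV \<phi> M \<and> norm (U n \<phi>) > C * M"
    by (auto simp: not_le)
  have add: "U n (\<lambda>x. \<phi> x + \<psi> x) = U n \<phi> + U n \<psi>" if "\<phi> \<in> test_in K" "\<psi> \<in> test_in K" for n \<phi> \<psi>
    using lin that by (auto simp: linear_functional_on_def)
  have cmult: "U n (\<lambda>x. c * \<phi> x) = c * U n \<phi>" if "\<phi> \<in> test_in K" for n c \<phi>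
    using lin that by (auto simp: linear_functional_on_def)
  have large: "\<exists>n. \<exists>\<phi>\<in>test_in K. derivs_le N UNIV \<phi> e \<and> norm (U n \<phi>) > B" if "e > 0" for e B :: real and N
  proof -
    define B' where "B' = \<bar>B\<bar> + 1"
    obtain n \<phi> M where \<phi>: "\<phi> \<in> test_in K" "derivs_le N UNIV \<phi> M" "norm (U n \<phi>) > B' / e * M"
      using neg[of N "B' / e"] by blast
    have M: "0 \<le> M" using derivs_le_nonneg[OF \<phi>(2)] by blast
    have "0 \<le> B' / e * M" using M that by (simp add: B'_def)
    then have pos: "norm (U n \<phi>) > 0" using \<phi>(3) by linarith
    \<comment> \<open>rescaling gives the functional a value of modulus \<open>B' > B\<close>\<close>
    define c where "c = B' / norm (U n \<phi>)"
    have "derivs_le N UNIV (\<lambda>x. of_real c * \<phi> x) (norm (of_real c :: complex) * M)"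
      by (rule derivs_le_cmult[OF open_UNIV test_inD(2)[OF \<phi>(1)] \<phi>(2)])
    moreover have "norm (of_real c :: complex) * M \<le> e"
    proof -
      have "B' * M \<le> e * norm (U n \<phi>)" using \<phi>(3) that by (simp add: field_simps)
      moreover have "B' \<ge> 0" by (simp add: B'_def)
      ultimately show ?thesis using pos by (simp add: c_def norm_divide field_simps)
    qed
    ultimately have "derivs_le N UNIV (\<lambda>x. of_real c * \<phi> x) e" using derivs_le_mono by blast
    moreover have "norm (U n (\<lambda>x. of_real c * \<phi> x)) > B"
      unfolding cmult[OF \<phi>(1)] using pos by (simp add: norm_mult norm_divide c_def B'_def)
    ultimately show ?thesis using test_in_cmult[OF \<phi>(1)] by blast
  qed
  \<comment> \<open>State of the recursion: \<open>s\<close> is the partial sum, and all later terms have derivatives of order at most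
    \<open>N\<close> bounded by \<open>e\<close>. The bounds \<open>e\<close> are at least halved in each step, so that the remaining series is
    bounded by \<open>2 e\<close>.\<close>
  define P where "P = (\<lambda>(i::nat) (s, N, e). s \<in> test_in K \<and> N \<ge> i \<and> 0 < e \<and> e \<le> (1/2::real) ^ i)"
  define Q where "Q = (\<lambda>(i::nat) (s, N, e) (s', N', e'). \<exists>n. \<exists>\<phi>\<in>test_in K.
      s' = (\<lambda>x. s x + \<phi> x) \<and> derivs_le N UNIV \<phi> e \<and> norm (U n s') > i + 1 \<and> N \<le> N' \<and> e' \<le> (e::real) / 2
      \<and> (\<forall>\<psi>\<in>test_in K. derivs_le N' UNIV \<psi> (2 * e') \<longrightarrow> norm (U n \<psi>) \<le> 1))"
  have "\<exists>F. \<forall>i. P i (F i) \<and> Q i (F i) (F (Suc i))"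
  proof (rule dependent_nat_choice)
    show "\<exists>x. P 0 x"
      by (rule exI[of _ "(\<lambda>x. 0, 0, 1)"]) (simp add: P_def zero_in_test_in)
  next
    fix X and i :: nat assume "P i X"
    then obtain s N e where X: "X = (s, N, e)" and s: "s \<in> test_in K" and N: "N \<ge> i"
      and e: "0 < e" "e \<le> (1/2) ^ i" by (cases X) (auto simp: P_def)
    obtain B where B: "\<And>n. norm (U n s) \<le> B" using bdd[OF s] by blast
    obtain n \<phi> where \<phi>: "\<phi> \<in> test_in K" "derivs_le N UNIV \<phi> e" "norm (U n \<phi>) > B + i + 1"
      using large[OF e(1)] by blast
    obtain C N0 where C: "\<And>\<phi> M. \<phi> \<in> test_in K \<Longrightarrow> derivs_le N0 UNIV \<phi> M \<Longrightarrow> norm (U n \<phi>) \<le> C * M"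
      using cont by blast
    define e' where "e' = min (e / 2) (1 / (2 * (\<bar>C\<bar> + 1)))"
    define N' where "N' = max (Suc N) N0"
    define s' where "s' = (\<lambda>x. s x + \<phi> x)"
    have "norm (U n \<psi>) \<le> 1" if "\<psi> \<in> test_in K" "derivs_le N' UNIV \<psi> (2 * e')" for \<psi>
    proof -
      have "norm (U n \<psi>) \<le> C * (2 * e')"
        by (rule C[OF that(1) derivs_le_mono[OF that(2)]]) (auto simp: N'_def)
      also have "\<dots> \<le> (\<bar>C\<bar> + 1) * (2 * e')" using e(1) by (intro mult_right_mono) (auto simp: e'_def)
      also have "\<dots> \<le> (\<bar>C\<bar> + 1) * (2 * (1 / (2 * (\<bar>C\<bar> + 1))))"
        by (intro mult_left_mono) (auto simp: e'_def)
      also have "\<dots> = 1" by (simp add: field_simps)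
      finally show ?thesis .
    qed
    moreover have "norm (U n s') > i + 1"
    proof -
      have "U n s' = U n s + U n \<phi>" unfolding s'_def by (rule add[OF s \<phi>(1)])
      then show ?thesis using norm_triangle_ineq2[of "U n \<phi>" "- U n s"] B[of n] \<phi>(3) by (simp add: add.commute)
    qed
    ultimately have "Q i X (s', N', e')"
      unfolding Q_def X using \<phi>(1,2) by (auto simp: s'_def N'_def e'_def intro!: exI[of _ n] bexI[of _ \<phi>])
    moreover have "P (Suc i) (s', N', e')"
      using N e test_in_add[OF s \<phi>(1)] by (auto simp: P_def s'_def N'_def e'_def)
    ultimately show "\<exists>Y. P (Suc i) Y \<and> Q i X Y" by blast
  qed
  then obtain F where F: "\<And>i. P i (F i)" "\<And>i. Q i (F i) (F (Suc i))" by blast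
  define s where "s i = fst (F i)" for i
  define N where "N i = fst (snd (F i))" for i
  define e where "e i = snd (snd (F i))" for i
  have FF: "F i = (s i, N i, e i)" for i by (simp add: s_def N_def e_def)
  have P: "s i \<in> test_in K" "N i \<ge> i" "0 < e i" "e i \<le> (1/2) ^ i" for i
    using F(1)[of i] by (auto simp: P_def FF)
  define R where "R i n \<phi> \<longleftrightarrow> \<phi> \<in> test_in K \<and> s (Suc i) = (\<lambda>x. s i x + \<phi> x)
      \<and> derivs_le (N i) UNIV \<phi> (e i) \<and> norm (U n (s (Suc i))) > real i + 1
      \<and> (\<forall>\<psi>\<in>test_in K. derivs_le (N (Suc i)) UNIV \<psi> (2 * e (Suc i)) \<longrightarrow> norm (U n \<psi>) \<le> 1)" for i n \<phi>
  have "\<exists>n \<phi>. R i n \<phi>" for i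
    using F(2)[of i] unfolding Q_def FF prod.case R_def by blast
  then obtain n \<phi> where "\<And>i. R i (n i) (\<phi> i)" by metis
  then have \<phi>: "\<And>i. \<phi> i \<in> test_in K" "\<And>i. s (Suc i) = (\<lambda>x. s i x + \<phi> i x)"
      "\<And>i. derivs_le (N i) UNIV (\<phi> i) (e i)" "\<And>i. norm (U (n i) (s (Suc i))) > real i + 1"
      "\<And>i \<psi>. \<psi> \<in> test_in K \<Longrightarrow> derivs_le (N (Suc i)) UNIV \<psi> (2 * e (Suc i)) \<Longrightarrow> norm (U (n i) \<psi>) \<le> 1"
    unfolding R_def by blast+
  have step: "N i \<le> N (Suc i)" "e (Suc i) \<le> e i / 2" for i
    using F(2)[of i] by (auto simp: Q_def FF)
  have Nmono: "N m \<le> N (i + m)" for m i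
    by (induction i) (auto intro: order_trans[OF _ step(1)])
  have edecr: "e (i + m) \<le> e m * (1/2) ^ i" for m i
  proof (induction i)
    case (Suc i)
    then show ?case using step(2)[of "i + m"] by simp
  qed simp
  have ds: "derivs_le (N m) UNIV (\<phi> (i + m)) (e m * (1/2) ^ i)" for m i
    by (rule derivs_le_mono[OF \<phi>(3) Nmono edecr])
  have ev: "\<forall>\<^sub>F i in sequentially. derivs_le k UNIV (\<phi> (i + m)) ((1/2) ^ i)" for k m
    using eventually_ge_at_top[of k]
  proof eventually_elim
    case (elim i)
    have "e (i + m) \<le> (1/2) ^ (i + m)" by (rule P)
    also have "\<dots> \<le> (1/2) ^ i" by (rule power_decreasing) auto
    finally show ?case using elim P(2)[of "i + m"] by (intro derivs_le_mono[OF \<phi>(3)]) auto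
  qed
  have sm: "smooth_on UNIV (\<phi> i)" for i using \<phi>(1) test_inD(1) by blast
  \<comment> \<open>the remainder of the series\<close>
  define t where "t m = (\<lambda>x. \<Sum>i. \<phi> (i + m) x)" for m
  have t_in: "t m \<in> test_in K" for m
    using iter_deriv_series(1)[OF sm ev[of _ m]] test_inD(3)[OF \<phi>(1)] unfolding t_def test_in_def by simp
  have t_le: "derivs_le (N m) UNIV (t m) (2 * e m)" for m
  proof (rule derivs_leI)
    fix bs :: "'a list" and x assume bs: "set bs \<subseteq> Basis" "length bs \<le> N m"
    have "(\<lambda>i. e m * (1/2) ^ i) sums (e m * (1 / (1 - 1/2)))"
      by (intro sums_mult geometric_sums) auto
    then have S: "(\<lambda>i. e m * (1/2) ^ i) sums (2 * e m)" by (simp add: mult.commute)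
    have le: "norm (iter_deriv bs (\<phi> (i + m)) x) \<le> e m * (1/2) ^ i" for i
      by (rule derivs_leD[OF ds bs UNIV_I])
    have "norm (\<Sum>i. iter_deriv bs (\<phi> (i + m)) x) \<le> (\<Sum>i. e m * (1/2) ^ i)"
      by (rule norm_suminf_le[OF le sums_summable[OF S]])
    then show "norm (iter_deriv bs (t m) x) \<le> 2 * e m"
      unfolding t_def using iter_deriv_series(3)[OF sm ev[of _ m] bs(1)] sums_unique[OF S] by simp
  qed
  have split: "(\<lambda>x. s 0 x + t 0 x) = (\<lambda>x. s m x + t m x)" for m
  proof
    fix x
    have "s m x = s 0 x + (\<Sum>i<m. \<phi> i x)" by (induction m) (auto simp: \<phi>(2))
    moreover have "t 0 x = t m x + (\<Sum>i<m. \<phi> i x)"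
      unfolding t_def using iter_deriv_series(2)[OF sm ev[of _ 0], of "[]"]
        suminf_split_initial_segment[of "\<lambda>i. \<phi> i x" m] by simp
    ultimately show "s 0 x + t 0 x = s m x + t m x" by simp
  qed
  obtain B where B: "\<And>n. norm (U n (\<lambda>x. s 0 x + t 0 x)) \<le> B"
    using bdd[OF test_in_add[OF P(1) t_in]] by blast
  obtain i :: nat where i: "real i > B" using reals_Archimedean2 by blast
  have "norm (U (n i) (s (Suc i)) + U (n i) (t (Suc i))) \<le> B"
    using B[of "n i"] unfolding split[of "Suc i"] add[OF P(1) t_in] .
  moreover have "norm (U (n i) (t (Suc i))) \<le> 1" by (rule \<phi>(5)[OF t_in t_le])
  ultimately show False
    using \<phi>(4)[of i] i norm_triangle_ineq2[of "U (n i) (s (Suc i))" "- U (n i) (t (Suc i))"] by simp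
qed

section \<open>Schwartz functions\<close>

lemma schwartz_smooth: "\<theta> \<in> schwartz_functions \<Longrightarrow> Ck_on k UNIV \<theta>"
  by (simp add: schwartz_functions_def smooth_on_def)

lemma schwartz_bdd:
  "\<theta> \<in> schwartz_functions \<Longrightarrow> \<alpha> \<in> multi_indices \<Longrightarrow> m \<in> multi_indices \<Longrightarrow>
    bdd_above (range (\<lambda>x. norm (of_real (monomial \<alpha> x) * mi_deriv m \<theta> x)))"
  by (simp add: schwartz_functions_def)

lemma zero_multi_index: "(\<lambda>_. 0) \<in> multi_indices" "order_mi (\<lambda>_. 0) = 0" "monomial (\<lambda>_. 0) x = 1"
  "mi_deriv (\<lambda>_. 0) f = f"
proof -
  show "mi_deriv (\<lambda>_. 0) f = f" unfolding mi_deriv_eq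
    by (metis length_mi_list length_0_conv iter_deriv_Nil order_mi_def sum.neutral_const)
qed (auto simp: multi_indices_def order_mi_def monomial_def)

text \<open>The bound uses only the Schwartz seminorms with trivial weight, and is the sum of those up to order \<open>N\<close>.\<close>

lemma schwartz_derivs_le:
  fixes \<theta> :: "'a::euclidean_space \<Rightarrow> complex"
  assumes "\<theta> \<in> schwartz_functions"
  shows "derivs_le N UNIV \<theta> (\<Sum>m | m \<in> multi_indices \<and> order_mi m \<le> N. SUP x. norm (mi_deriv m \<theta> x))"
proof (rule derivs_le_of_mi_deriv[OF open_UNIV schwartz_smooth[OF assms] subset_UNIV])
  fix m :: "'a \<Rightarrow> nat" and x assume m: "m \<in> multi_indices" "order_mi m \<le> N"
  have bdd: "bdd_above (range (\<lambda>x. norm (mi_deriv m' \<theta> x)))" if "m' \<in> multi_indices" for m'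
    using schwartz_bdd[OF assms zero_multi_index(1) that] by (simp add: zero_multi_index)
  have "norm (mi_deriv m \<theta> x) \<le> (SUP x. norm (mi_deriv m \<theta> x))"
    by (rule cSUP_upper[OF UNIV_I bdd[OF m(1)]])
  also have "\<dots> \<le> (\<Sum>m | m \<in> multi_indices \<and> order_mi m \<le> N. SUP x. norm (mi_deriv m \<theta> x))"
    using m finite_multi_indices bdd
    by (intro member_le_sum) (auto intro: cSUP_upper2[OF bdd UNIV_I norm_ge_zero])
  finally show "norm (mi_deriv m \<theta> x) \<le> (\<Sum>m | m \<in> multi_indices \<and> order_mi m \<le> N. SUP x. norm (mi_deriv m \<theta> x))" .
qed

lemma integrable_inverse_1_plus_square: "integrable lborel (\<lambda>x::real. 1 / (1 + x\<^sup>2))"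
proof -
  have "set_integrable lborel (einterval (- \<infinity>) \<infinity>) (\<lambda>x::real. 1 / (1 + x\<^sup>2))"
  proof (rule interval_integral_FTC_nonneg(1)[where F=arctan])
    show "(arctan has_real_derivative 1 / (1 + x\<^sup>2)) (at x)" for x
      using DERIV_arctan[of x] by (simp add: inverse_eq_divide)
    show "isCont (\<lambda>x::real. 1 / (1 + x\<^sup>2)) x" for x
      by (intro continuous_intros) (use sum_power2_gt_zero_iff[of 1 x] in auto)
    show "((arctan \<circ> real_of_ereal) \<longlongrightarrow> - (pi/2)) (at_right (- \<infinity>))"
      by (simp add: ereal_tendsto_simps tendsto_arctan_at_bot)
    show "((arctan \<circ> real_of_ereal) \<longlongrightarrow> pi/2) (at_left \<infinity>)"
      by (simp add: ereal_tendsto_simps tendsto_arctan_at_top)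
  qed auto
  then show ?thesis by (simp add: set_integrable_def einterval_def)
qed

lemma integrable_prod_inverse_1_plus_square:
  "integrable lborel (\<lambda>x::'a::euclidean_space. \<Prod>b\<in>Basis. 1 / (1 + (x \<bullet> b)\<^sup>2))"
proof (rule integrableI_nonneg)
  have "(\<integral>\<^sup>+x. (\<Prod>b\<in>Basis. ennreal (1 / (1 + ((x::'a) \<bullet> b)\<^sup>2))) \<partial>lborel)
      = (\<Prod>b\<in>(Basis::'a set). \<integral>\<^sup>+x. ennreal (1 / (1 + x\<^sup>2)) \<partial>lborel)"
    by (rule nn_integral_lborel_prod) auto
  also have "\<dots> < \<infinity>"
    using integrableD(2)[OF integrable_inverse_1_plus_square]
    by (simp add: power_less_top_ennreal less_top)
  finally show "(\<integral>\<^sup>+x. ennreal (\<Prod>b\<in>Basis. 1 / (1 + ((x::'a) \<bullet> b)\<^sup>2)) \<partial>lborel) < \<infinity>"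
    by (simp add: prod_ennreal)
qed (auto intro!: prod_nonneg)

lemma norm_power_le_sum:
  fixes x :: "'a::euclidean_space"
  shows "norm x ^ l \<le> real DIM('a) ^ l * (\<Sum>b\<in>Basis. \<bar>x \<bullet> b\<bar> ^ l)"
proof -
  have "\<exists>b\<in>Basis. norm x \<le> real DIM('a) * \<bar>x \<bullet> b\<bar>"
  proof (rule ccontr)
    assume "\<not> ?thesis"
    then have "\<bar>x \<bullet> b\<bar> < norm x / DIM('a)" if "b \<in> Basis" for b
      using that by (simp add: field_simps not_le)
    then have "(\<Sum>b\<in>Basis. \<bar>x \<bullet> b\<bar>) < (\<Sum>b\<in>(Basis::'a set). norm x / DIM('a))"
      by (intro sum_strict_mono) auto
    then show False using norm_le_l1[of x] by simp
  qed
  then obtain b where b: "b \<in> Basis" "norm x \<le> real DIM('a) * \<bar>x \<bullet> b\<bar>" by blast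
  have "norm x ^ l \<le> (real DIM('a) * \<bar>x \<bullet> b\<bar>) ^ l" using b by (intro power_mono) auto
  also have "\<dots> \<le> real DIM('a) ^ l * (\<Sum>b\<in>Basis. \<bar>x \<bullet> b\<bar> ^ l)"
    unfolding power_mult_distrib using b
    by (intro mult_left_mono member_le_sum) auto
  finally show ?thesis .
qed

text \<open>After \<open>norm x ^ l\<close> has been replaced by powers of the coordinates, multiplying out
  \<open>\<Prod>(1 + (x \<bullet> b)\<^sup>2)\<close> leaves a finite sum of monomials, each bounded against \<open>\<theta>\<close>.\<close>

lemma schwartz_decay:
  fixes \<theta> :: "'a::euclidean_space \<Rightarrow> complex"
  assumes "\<theta> \<in> schwartz_functions"
  shows "\<exists>C. \<forall>x. norm x ^ l * norm (\<theta> x) \<le> C * (\<Prod>b\<in>Basis. 1 / (1 + (x \<bullet> b)\<^sup>2))"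
proof -
  define \<alpha> where "\<alpha> b X = (\<lambda>i::'a. (if i = b then l else 0) + (if i \<in> X then 2 else 0))" for b and X :: "'a set"
  have mon: "\<exists>C. \<forall>x. \<bar>monomial (\<alpha> b X) x\<bar> * norm (\<theta> x) \<le> C" if "b \<in> Basis" "X \<subseteq> Basis" for b X
  proof -
    have "\<alpha> b X \<in> multi_indices" using that by (auto simp: multi_indices_def \<alpha>_def)
    from schwartz_bdd[OF assms this zero_multi_index(1)]
    show ?thesis by (auto simp: zero_multi_index norm_mult bdd_above_def)
  qed
  then obtain C where C: "\<And>b X x. b \<in> Basis \<Longrightarrow> X \<subseteq> Basis \<Longrightarrow> \<bar>monomial (\<alpha> b X) x\<bar> * norm (\<theta> x) \<le> C b X"
    by metis
  define D where "D = real DIM('a) ^ l * (\<Sum>b\<in>Basis. \<Sum>X\<in>Pow Basis. C b X)"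
  have "norm x ^ l * norm (\<theta> x) \<le> D * (\<Prod>b\<in>Basis. 1 / (1 + (x \<bullet> b)\<^sup>2))" for x
  proof -
    have pos: "1 + (x \<bullet> b)\<^sup>2 > 0" for b by (simp add: add_pos_nonneg)
    have meq: "\<bar>x \<bullet> b\<bar> ^ l * (\<Prod>i\<in>X. (x \<bullet> i)\<^sup>2) = \<bar>monomial (\<alpha> b X) x\<bar>" if "b \<in> Basis" "X \<subseteq> Basis" for b X
    proof -
      have "monomial (\<alpha> b X) x = (\<Prod>i\<in>Basis. if i = b then (x \<bullet> i) ^ l else 1) * (\<Prod>i\<in>Basis. if i \<in> X then (x \<bullet> i)\<^sup>2 else 1)"
        unfolding monomial_def \<alpha>_def power_add prod.distrib
        by (intro arg_cong2[of _ _ _ _ "(*)"] prod.cong) auto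
      also have "(\<Prod>i\<in>Basis. if i = b then (x \<bullet> i) ^ l else 1) = (x \<bullet> b) ^ l" using that by simp
      also have "(\<Prod>i\<in>Basis. if i \<in> X then (x \<bullet> i)\<^sup>2 else 1) = (\<Prod>i\<in>X. (x \<bullet> i)\<^sup>2)"
        using that by (simp add: prod.inter_restrict[symmetric] Int_absorb1)
      finally show ?thesis by (simp add: abs_mult power_abs prod_nonneg)
    qed
    have expand: "(\<Prod>b\<in>Basis. 1 + (x \<bullet> b)\<^sup>2) = (\<Sum>X\<in>Pow Basis. \<Prod>i\<in>X. (x \<bullet> i)\<^sup>2)"
      using prod_add[OF finite_Basis, of "\<lambda>b. (x \<bullet> b)\<^sup>2" "\<lambda>b. 1"] by (simp add: add.commute)
    have "norm x ^ l * norm (\<theta> x) * (\<Prod>b\<in>Basis. 1 + (x \<bullet> b)\<^sup>2)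
       \<le> (real DIM('a) ^ l * (\<Sum>b\<in>Basis. \<bar>x \<bullet> b\<bar> ^ l)) * norm (\<theta> x) * (\<Prod>b\<in>Basis. 1 + (x \<bullet> b)\<^sup>2)"
      by (intro mult_right_mono norm_power_le_sum prod_nonneg) auto
    also have "\<dots> = real DIM('a) ^ l * (\<Sum>b\<in>Basis. \<Sum>X\<in>Pow Basis. (\<bar>x \<bullet> b\<bar> ^ l * (\<Prod>i\<in>X. (x \<bullet> i)\<^sup>2)) * norm (\<theta> x))"
      unfolding expand by (simp add: sum_distrib_left sum_distrib_right mult_ac)
    also have "\<dots> \<le> D"
      unfolding D_def by (intro mult_left_mono sum_mono) (use C meq in auto)
    finally have "norm x ^ l * norm (\<theta> x) * (\<Prod>b\<in>Basis. 1 + (x \<bullet> b)\<^sup>2) \<le> D" .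
    moreover have "(\<Prod>b\<in>(Basis::'a set). 1 + (x \<bullet> b)\<^sup>2) > 0" using pos by (intro prod_pos) auto
    ultimately show ?thesis by (simp add: prod_dividef field_simps)
  qed
  then show ?thesis by blast
qed

lemma continuous_borel_measurable: "Ck_on k UNIV f \<Longrightarrow> f \<in> borel_measurable borel"
  by (intro borel_measurable_continuous_onI Ck_on_continuous)

lemma schwartz_integrable:
  assumes "\<theta> \<in> schwartz_functions"
  shows "integrable lborel (\<lambda>x. norm x ^ l * norm (\<theta> x))"
proof -
  obtain C where C: "\<And>x. norm x ^ l * norm (\<theta> x) \<le> C * (\<Prod>b\<in>Basis. 1 / (1 + (x \<bullet> b)\<^sup>2))"
    using schwartz_decay[OF assms] by blast
  have [measurable]: "\<theta> \<in> borel_measurable borel"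
    by (rule continuous_borel_measurable[OF schwartz_smooth[OF assms]])
  show ?thesis
  proof (rule Bochner_Integration.integrable_bound)
    show "integrable lborel (\<lambda>x::'a. C * (\<Prod>b\<in>Basis. 1 / (1 + (x \<bullet> b)\<^sup>2)))"
      by (intro integrable_mult_right integrable_prod_inverse_1_plus_square)
    show "AE x in lborel. norm (norm x ^ l * norm (\<theta> x)) \<le> norm (C * (\<Prod>b\<in>Basis. 1 / (1 + (x \<bullet> b)\<^sup>2)))"
      using C by (auto intro!: AE_I2 intro: order_trans[OF C abs_ge_self])
  qed simp
qed

section \<open>Taylor expansion against vanishing moments\<close>

text \<open>The lists of \<open>i\<close> basis vectors, which index the derivatives of order \<open>i\<close> with repetition.\<close>

definition Blists :: "nat \<Rightarrow> 'a::euclidean_space list set"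
  where "Blists i = {bs. set bs \<subseteq> Basis \<and> length bs = i}"

lemma finite_Blists [simp]: "finite (Blists i)"
  unfolding Blists_def by (rule finite_lists_length_eq) simp

lemma card_Blists: "card (Blists i :: 'a::euclidean_space list set) = DIM('a) ^ i"
  unfolding Blists_def by (rule card_lists_length_eq) simp

lemma sum_Blists_0:
  fixes F :: "'a::euclidean_space list \<Rightarrow> 'b::comm_monoid_add"
  shows "(\<Sum>bs\<in>Blists 0. F bs) = F []"
proof -
  have "Blists 0 = {[] :: 'a list}" by (auto simp: Blists_def)
  then show ?thesis by simp
qed

lemma sum_Blists_Suc:
  fixes F :: "'a::euclidean_space list \<Rightarrow> 'b::comm_monoid_add"
  shows "(\<Sum>bs\<in>Blists (Suc i). F bs) = (\<Sum>bs\<in>Blists i. \<Sum>b\<in>Basis. F (b # bs))"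
proof -
  have "(Blists (Suc i) :: 'a list set) = (\<lambda>(bs, b). b # bs) ` (Blists i \<times> Basis)"
    by (auto simp: Blists_def length_Suc_conv image_iff)
  moreover have "inj_on (\<lambda>(bs, b). b # bs) (Blists i \<times> (Basis :: 'a set))" by (auto simp: inj_on_def)
  ultimately show ?thesis by (simp add: sum.reindex sum.cartesian_product case_prod_unfold)
qed

text \<open>The \<open>i\<close>-th directional derivative of \<open>f\<close> along \<open>w\<close>, expanded in partial derivatives.\<close>

definition dir_deriv :: "'a::euclidean_space \<Rightarrow> ('a \<Rightarrow> complex) \<Rightarrow> nat \<Rightarrow> 'a \<Rightarrow> complex"
  where "dir_deriv w f i x = (\<Sum>bs\<in>Blists i. of_real (\<Prod>b\<leftarrow>bs. w \<bullet> b) * iter_deriv bs f x)"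

lemma has_vector_derivative_dir_deriv:
  assumes "Ck_on (Suc i) UNIV f"
  shows "((\<lambda>t. dir_deriv w f i (x + t *\<^sub>R w)) has_vector_derivative dir_deriv w f (Suc i) (x + t *\<^sub>R w)) (at t)"
proof -
  have d: "iter_deriv bs f differentiable (at y)" if "bs \<in> Blists i" for bs y
    using Ck_on_iter_deriv[of "Suc 0" bs UNIV f] that assms by (auto simp: Blists_def)
  have "((\<lambda>t. dir_deriv w f i (x + t *\<^sub>R w)) has_vector_derivative
      (\<Sum>bs\<in>Blists i. of_real (\<Prod>b\<leftarrow>bs. w \<bullet> b) *
        (\<Sum>b\<in>Basis. of_real (w \<bullet> b) * partial_deriv b (iter_deriv bs f) (x + t *\<^sub>R w)))) (at t)"
    unfolding dir_deriv_def
    by (intro has_vector_derivative_sum has_vector_derivative_mult_right has_vector_derivative_line d)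
  also have "(\<Sum>bs\<in>Blists i. of_real (\<Prod>b\<leftarrow>bs. w \<bullet> b) *
        (\<Sum>b\<in>Basis. of_real (w \<bullet> b) * partial_deriv b (iter_deriv bs f) (x + t *\<^sub>R w)))
      = dir_deriv w f (Suc i) (x + t *\<^sub>R w)"
    unfolding dir_deriv_def sum_Blists_Suc
    by (intro sum.cong refl) (simp add: sum_distrib_left mult_ac)
  finally show ?thesis .
qed

lemma norm_dir_deriv_le:
  fixes w :: "'a::euclidean_space"
  assumes "derivs_le i UNIV f M"
  shows "norm (dir_deriv w f i x) \<le> DIM('a) ^ i * norm w ^ i * M"
proof -
  have "norm (of_real (\<Prod>b\<leftarrow>bs. w \<bullet> b) * iter_deriv bs f x) \<le> norm w ^ i * M" if bs: "bs \<in> Blists i" for bs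
  proof -
    have "set cs \<subseteq> Basis \<Longrightarrow> \<bar>\<Prod>b\<leftarrow>cs. w \<bullet> b\<bar> \<le> norm w ^ length cs" for cs
      by (induction cs) (auto simp: abs_mult intro!: mult_mono Basis_le_norm)
    then have "\<bar>\<Prod>b\<leftarrow>bs. w \<bullet> b\<bar> \<le> norm w ^ i" using bs by (auto simp: Blists_def)
    moreover have "norm (iter_deriv bs f x) \<le> M" using bs by (intro derivs_leD[OF assms]) (auto simp: Blists_def)
    ultimately show ?thesis unfolding norm_mult norm_of_real by (intro mult_mono) auto
  qed
  then have "norm (dir_deriv w f i x) \<le> (\<Sum>bs\<in>(Blists i :: 'a list set). norm w ^ i * M)"
    unfolding dir_deriv_def by (rule sum_norm_le)
  then show ?thesis by (simp add: card_Blists mult_ac)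
qed

lemma taylor_estimate:
  fixes f :: "'a::euclidean_space \<Rightarrow> complex"
  assumes "Ck_on l UNIV f" "derivs_le l UNIV f M"
  shows "norm (f (x + w) - (\<Sum>i<l. dir_deriv w f i x / fact i)) \<le> DIM('a) ^ l * norm w ^ l * M"
proof -
  define r where "r = f (x + w) - (\<Sum>i<l. dir_deriv w f i x / fact i)"
  \<comment> \<open>multiplying the remainder \<open>r\<close> by \<open>u\<close> makes it real and nonnegative, which reduces the claim to the
    Taylor formula for real-valued functions\<close>
  define u where "u = cnj (sgn r)"
  define diff where "diff m t = Re (u * dir_deriv w f m (x + t *\<^sub>R w))" for m t
  have u: "norm u \<le> 1" by (simp add: u_def norm_sgn)
  have ur: "Re (u * r) = norm r"
  proof (cases "r = 0")
    case False
    have "u * r = cnj r * r / norm r" by (simp add: u_def sgn_eq)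
    also have "\<dots> = norm r" using False
      by (simp add: mult.commute[of "cnj r"] complex_norm_square[symmetric] power2_eq_square)
    finally show ?thesis by simp
  qed simp
  have DERIV: "DERIV (diff m) t :> diff (Suc m) t" if "m < l" for m t
  proof -
    have "Ck_on (Suc m) UNIV f" using that assms(1) by (intro Ck_on_mono[OF assms(1)]) auto
    from has_vector_derivative_mult_right[OF has_vector_derivative_dir_deriv[OF this, of w x t], of u]
    have "((\<lambda>t. Re (u * dir_deriv w f m (x + t *\<^sub>R w))) has_vector_derivative
        Re (u * dir_deriv w f (Suc m) (x + t *\<^sub>R w))) (at t)"
      by (rule bounded_linear.has_vector_derivative[OF bounded_linear_Re])
    then show ?thesis by (simp add: diff_def[abs_def] has_real_derivative_iff_has_vector_derivative)
  qed
  obtain t where t: "diff 0 1 = (\<Sum>m<l. diff m 0 / fact m * 1 ^ m) + diff l t / fact l * 1 ^ l"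
    using Maclaurin_bi_le[of diff "diff 0" l 1] DERIV by auto
  have Re_fact: "Re (z / fact m) = Re z / fact m" for z m
    by (metis Re_divide_of_real of_real_fact)
  have "u * r = u * f (x + w) - (\<Sum>m<l. u * dir_deriv w f m x / fact m)"
    by (simp add: r_def right_diff_distrib sum_distrib_left)
  from arg_cong[OF this, of Re] have "norm r = Re (u * f (x + w)) - (\<Sum>m<l. Re (u * dir_deriv w f m x) / fact m)"
    unfolding ur by (simp add: Re_fact del: times_complex.sel)
  also have "\<dots> = diff l t / fact l"
    using t by (simp add: diff_def dir_deriv_def sum_Blists_0)
  also have "\<dots> \<le> \<bar>diff l t\<bar>"
    using frac_le[of "\<bar>diff l t\<bar>" "diff l t" 1 "fact l"] by simp
  also have "\<dots> \<le> norm (dir_deriv w f l (x + t *\<^sub>R w))"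
    unfolding diff_def using u
    by (intro order_trans[OF abs_Re_le_cmod]) (simp add: norm_mult mult_left_le_one_le)
  also have "\<dots> \<le> DIM('a) ^ l * norm w ^ l * M" by (rule norm_dir_deriv_le[OF assms(2)])
  finally show ?thesis unfolding r_def .
qed

lemma monomial_count_list:
  "set bs \<subseteq> Basis \<Longrightarrow> monomial (count_list bs) x = (\<Prod>b\<leftarrow>bs. x \<bullet> b)"
proof (induction bs)
  case (Cons b bs)
  have "monomial (count_list (b # bs)) x = (\<Prod>i\<in>Basis. (if i = b then x \<bullet> i else 1) * (x \<bullet> i) ^ count_list bs i)"
    unfolding monomial_def by (intro prod.cong) auto
  also have "\<dots> = (x \<bullet> b) * monomial (count_list bs) x"
    using Cons.prems by (simp add: prod.distrib monomial_def)
  finally show ?case using Cons.IH Cons.prems by (simp del: count_list.simps)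
qed (simp add: monomial_def)

lemma abs_monomial_le: "\<bar>monomial m x\<bar> \<le> norm x ^ order_mi m"
proof -
  have "\<bar>monomial m x\<bar> \<le> (\<Prod>b\<in>Basis. norm x ^ m b)"
    unfolding monomial_def abs_prod power_abs
    by (intro prod_mono) (auto intro!: power_mono Basis_le_norm)
  then show ?thesis by (simp add: order_mi_def power_sum)
qed

lemma monomial_borel [measurable]: "monomial m \<in> borel_measurable borel"
  unfolding monomial_def[abs_def] by measurable

lemma schwartz_borel: "\<theta> \<in> schwartz_functions \<Longrightarrow> \<theta> \<in> borel_measurable borel"
  by (rule continuous_borel_measurable[OF schwartz_smooth])

lemma monomial_schwartz_integrable:
  assumes "\<theta> \<in> schwartz_functions"
  shows "integrable lborel (\<lambda>x. of_real (monomial m x) * \<theta> x)"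
proof (rule Bochner_Integration.integrable_bound[OF schwartz_integrable[OF assms, of "order_mi m"]])
  show "(\<lambda>x. of_real (monomial m x) * \<theta> x) \<in> borel_measurable lborel"
    using schwartz_borel[OF assms] by measurable
  show "AE x in lborel. norm (of_real (monomial m x) * \<theta> x) \<le> norm (norm x ^ order_mi m * norm (\<theta> x))"
    by (intro AE_I2) (simp add: norm_mult mult_right_mono abs_monomial_le)
qed

text \<open>The average of a \<open>C\<^sup>l\<close> function against a kernel of scale \<open>c\<close> is of size \<open>\<bar>c\<bar> ^ l\<close> if the moments of
  order less than \<open>l\<close> vanish, because the Taylor polynomial of degree less than \<open>l\<close> does not
  contribute.\<close>

lemma vanishing_moments_estimate:
  fixes g \<theta> :: "'a::euclidean_space \<Rightarrow> complex"
  assumes g: "Ck_on l UNIV g" "derivs_le l UNIV g M" and \<theta>: "\<theta> \<in> schwartz_functions"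
    and mom: "\<And>m. m \<in> multi_indices \<Longrightarrow> order_mi m < l \<Longrightarrow> (LINT z|lborel. of_real (monomial m z) * \<theta> z) = 0"
  shows "norm (LINT z|lborel. g (x + c *\<^sub>R z) * \<theta> z)
    \<le> DIM('a) ^ l * (LINT z|lborel. norm z ^ l * norm (\<theta> z)) * (\<bar>c\<bar> ^ l * M)"
proof -
  note [measurable] = schwartz_borel[OF \<theta>]
  have cont: "continuous_on UNIV g" by (rule Ck_on_continuous[OF g(1)])
  have [measurable]: "(\<lambda>z. g (x + c *\<^sub>R z)) \<in> borel_measurable borel"
    by (intro borel_measurable_continuous_onI continuous_on_compose2[OF cont] continuous_intros) auto
  \<comment> \<open>the Taylor polynomial at \<open>x\<close>, a combination of monomials in \<open>z\<close>\<close>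
  define P where "P z = (\<Sum>i<l. dir_deriv (c *\<^sub>R z) g i x / fact i)" for z
  have Peq: "P z * \<theta> z = (\<Sum>i<l. \<Sum>bs\<in>Blists i. (of_real (c ^ i) * iter_deriv bs g x / fact i) *
      (of_real (monomial (count_list bs) z) * \<theta> z))" for z
  proof -
    have dir: "(\<Prod>b\<leftarrow>bs. (c *\<^sub>R z) \<bullet> b) = c ^ i * monomial (count_list bs) z" if "bs \<in> Blists i" for i bs
    proof -
      have "(\<Prod>b\<leftarrow>cs. (c *\<^sub>R z) \<bullet> b) = c ^ length cs * (\<Prod>b\<leftarrow>cs. z \<bullet> b)" for cs
        by (induction cs) (auto simp: mult_ac)
      then show ?thesis using that monomial_count_list[of bs z] by (auto simp: Blists_def)
    qed
    show ?thesis
      unfolding P_def dir_deriv_def sum_distrib_right sum_divide_distrib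
      by (intro sum.cong refl, simp only: dir) (simp add: mult_ac)
  qed
  have intP: "integrable lborel (\<lambda>z. P z * \<theta> z)"
    unfolding Peq
    by (intro Bochner_Integration.integrable_sum integrable_mult_right monomial_schwartz_integrable[OF \<theta>])
  have P0: "(LINT z|lborel. P z * \<theta> z) = 0"
  proof -
    have "(LINT z|lborel. P z * \<theta> z) = (\<Sum>i<l. \<Sum>bs\<in>Blists i. (of_real (c ^ i) * iter_deriv bs g x / fact i) *
      (LINT z|lborel. of_real (monomial (count_list bs) z) * \<theta> z))"
      unfolding Peq
      by (subst Bochner_Integration.integral_sum Bochner_Integration.integral_mult_right;
          (intro Bochner_Integration.integrable_sum integrable_mult_right monomial_schwartz_integrable[OF \<theta>])?)+
        (intro sum.cong refl; subst Bochner_Integration.integral_sum Bochner_Integration.integral_mult_right;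
          (intro Bochner_Integration.integrable_sum integrable_mult_right monomial_schwartz_integrable[OF \<theta>])?)+
    also have "\<dots> = 0"
      using mom by (intro sum.neutral ballI) (auto simp: Blists_def count_list_multi_index)
    finally show ?thesis .
  qed
  have le: "norm ((g (x + c *\<^sub>R z) - P z) * \<theta> z) \<le> DIM('a) ^ l * (\<bar>c\<bar> ^ l * M) * (norm z ^ l * norm (\<theta> z))" for z
  proof -
    have "norm (g (x + c *\<^sub>R z) - P z) \<le> DIM('a) ^ l * norm (c *\<^sub>R z) ^ l * M"
      unfolding P_def by (rule taylor_estimate[OF g])
    from mult_right_mono[OF this norm_ge_zero[of "\<theta> z"]]
    show ?thesis by (simp add: norm_mult power_mult_distrib mult_ac)
  qed
  have int_bd: "integrable lborel (\<lambda>z. DIM('a) ^ l * (\<bar>c\<bar> ^ l * M) * (norm z ^ l * norm (\<theta> z)))"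
    by (intro integrable_mult_right schwartz_integrable[OF \<theta>])
  have [measurable]: "P \<in> borel_measurable borel"
  proof -
    have "P z = (\<Sum>i<l. \<Sum>bs\<in>Blists i. of_real (\<Prod>b\<leftarrow>bs. (c *\<^sub>R z) \<bullet> b) * iter_deriv bs g x / fact i)" for z
      by (simp add: P_def dir_deriv_def sum_divide_distrib)
    moreover have "continuous_on UNIV (\<lambda>z. \<Prod>b\<leftarrow>bs. (c *\<^sub>R z) \<bullet> b)" for bs :: "'a list"
      by (induction bs) (auto intro!: continuous_intros)
    ultimately show ?thesis
      by (subst ext[of P]) (auto intro!: borel_measurable_continuous_onI continuous_intros)
  qed
  have intR: "integrable lborel (\<lambda>z. (g (x + c *\<^sub>R z) - P z) * \<theta> z)"
    by (rule Bochner_Integration.integrable_bound[OF int_bd])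
      (measurable, intro AE_I2, unfold real_norm_def, rule order_trans[OF le abs_ge_self])
  have "(LINT z|lborel. g (x + c *\<^sub>R z) * \<theta> z) = (LINT z|lborel. (g (x + c *\<^sub>R z) - P z) * \<theta> z + P z * \<theta> z)"
    by (simp add: algebra_simps)
  also have "\<dots> = (LINT z|lborel. (g (x + c *\<^sub>R z) - P z) * \<theta> z)"
    using Bochner_Integration.integral_add[OF intR intP] P0 by simp
  finally have eq: "(LINT z|lborel. g (x + c *\<^sub>R z) * \<theta> z) = (LINT z|lborel. (g (x + c *\<^sub>R z) - P z) * \<theta> z)" .
  have "norm (LINT z|lborel. (g (x + c *\<^sub>R z) - P z) * \<theta> z)
      \<le> (LINT z|lborel. DIM('a) ^ l * (\<bar>c\<bar> ^ l * M) * (norm z ^ l * norm (\<theta> z)))"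
    by (rule order_trans[OF integral_norm_bound]) (intro integral_mono integrable_norm intR int_bd le)
  also have "\<dots> = DIM('a) ^ l * (\<bar>c\<bar> ^ l * M) * (LINT z|lborel. norm z ^ l * norm (\<theta> z))"
    by (rule Bochner_Integration.integral_mult_right) (intro impI schwartz_integrable[OF \<theta>])
  finally show ?thesis unfolding eq by (simp add: mult_ac)
qed

lemma integral_lborel_affine:
  fixes h :: "'a::euclidean_space \<Rightarrow> complex"
  assumes [measurable]: "h \<in> borel_measurable borel" and "c \<noteq> 0"
  shows "(LINT y|lborel. h y) = of_real (\<bar>c\<bar> ^ DIM('a)) * (LINT z|lborel. h (t + c *\<^sub>R z))"
proof -
  have "(LINT y|lborel. h y) = (LINT y|density (distr lborel borel (\<lambda>z. t + c *\<^sub>R z)) (\<lambda>_. \<bar>c\<bar> ^ DIM('a)). h y)"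
    by (subst lborel_affine[OF assms(2), of t]) simp
  also have "\<dots> = \<bar>c\<bar> ^ DIM('a) *\<^sub>R (LINT z|lborel. h (t + c *\<^sub>R z))"
    by (subst integral_density) (auto simp: integral_distr)
  finally show ?thesis by (simp add: scaleR_conv_of_real)
qed

section \<open>Distributions and their approximations\<close>

text \<open>For a positive comparison function, the finitely many exceptional indices can be absorbed into the
  constant.\<close>

lemma bigo_uniform:
  fixes g h :: "nat \<Rightarrow> real"
  assumes "g \<in> O(h)" "\<And>n. 1 \<le> n \<Longrightarrow> h n > 0"
  shows "\<exists>C\<ge>0. \<forall>n\<ge>1. \<bar>g n\<bar> \<le> C * h n"
proof -
  obtain c where c: "c > 0" "\<forall>\<^sub>F n in sequentially. norm (g n) \<le> c * norm (h n)"
    using assms(1) by (elim landau_o.bigE)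
  then obtain n0 where n0: "\<And>n. n \<ge> n0 \<Longrightarrow> norm (g n) \<le> c * norm (h n)"
    by (auto simp: eventually_sequentially)
  define C where "C = c + (\<Sum>n\<in>{1..<n0}. \<bar>g n\<bar> / h n)"
  have pos: "0 \<le> (\<Sum>n\<in>{1..<n0}. \<bar>g n\<bar> / h n)"
    by (intro sum_nonneg divide_nonneg_pos assms(2)) auto
  have "\<bar>g n\<bar> \<le> C * h n" if "n \<ge> 1" for n
  proof (cases "n \<ge> n0")
    case True
    then have "\<bar>g n\<bar> \<le> c * h n" using n0[of n] assms(2)[OF that] by simp
    also have "\<dots> \<le> C * h n" using pos assms(2)[OF that] by (intro mult_right_mono) (auto simp: C_def)
    finally show ?thesis .
  next
    case False
    have "\<bar>g n\<bar> / h n \<le> (\<Sum>n\<in>{1..<n0}. \<bar>g n\<bar> / h n)"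
      using False that by (intro member_le_sum divide_nonneg_pos assms(2)) auto
    then have "\<bar>g n\<bar> / h n \<le> C" using c by (simp add: C_def)
    then show ?thesis using assms(2)[OF that] by (simp add: field_simps)
  qed
  moreover have "C \<ge> 0" using pos c by (simp add: C_def)
  ultimately show ?thesis by blast
qed

lemma distribution_estimate:
  assumes "T \<in> distributions \<Omega>" "compact K" "K \<subseteq> \<Omega>"
  shows "\<exists>C N. \<forall>\<phi>\<in>test_in K. \<forall>M. derivs_le N UNIV \<phi> M \<longrightarrow> norm (T \<phi>) \<le> C * M"
proof -
  obtain C N where C: "\<And>\<phi>. \<phi> \<in> test_functions \<Omega> \<Longrightarrow> supp \<phi> \<subseteq> K \<Longrightarrow>
      norm (T \<phi>) \<le> C * (\<Sum>m | m \<in> multi_indices \<and> order_mi m \<le> N. SUP x. norm (mi_deriv m \<phi> x))"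
  proof -
    have "\<forall>K. compact K \<and> K \<subseteq> \<Omega> \<longrightarrow> (\<exists>C N. \<forall>\<phi>\<in>test_functions \<Omega>. supp \<phi> \<subseteq> K \<longrightarrow>
        norm (T \<phi>) \<le> C * (\<Sum>m | m \<in> multi_indices \<and> order_mi m \<le> N. SUP x. norm (mi_deriv m \<phi> x)))"
      using assms(1) by (simp add: distributions_def)
    from this[rule_format, of K] assms(2,3) show ?thesis using that by blast
  qed
  let ?I = "{m. m \<in> multi_indices \<and> order_mi (m :: 'a \<Rightarrow> nat) \<le> N}"
  have "norm (T \<phi>) \<le> (\<bar>C\<bar> * card ?I) * M" if \<phi>: "\<phi> \<in> test_in K" "derivs_le N UNIV \<phi> M" for \<phi> M
  proof -
    have le: "norm (mi_deriv m \<phi> x) \<le> M" if "m \<in> ?I" for m x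
      using that by (intro norm_mi_deriv_le[OF \<phi>(2)]) auto
    have bdd: "bdd_above (range (\<lambda>x. norm (mi_deriv m \<phi> x)))" if "m \<in> ?I" for m
      by (rule bdd_aboveI2[OF le[OF that]])
    have S: "0 \<le> (SUP x. norm (mi_deriv m \<phi> x))" "(SUP x. norm (mi_deriv m \<phi> x)) \<le> M" if "m \<in> ?I" for m
    proof -
      show "0 \<le> (SUP x. norm (mi_deriv m \<phi> x))"
        by (rule order_trans[OF norm_ge_zero cSUP_upper[OF UNIV_I bdd[OF that]]])
      show "(SUP x. norm (mi_deriv m \<phi> x)) \<le> M" by (rule cSUP_least) (use le[OF that] in auto)
    qed
    have "norm (T \<phi>) \<le> C * (\<Sum>m\<in>?I. SUP x. norm (mi_deriv m \<phi> x))"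
      using C test_in_subset[OF assms(2,3)] test_in_supp[OF assms(2)] \<phi>(1) by blast
    also have "\<dots> \<le> \<bar>C\<bar> * (\<Sum>m\<in>?I. SUP x. norm (mi_deriv m \<phi> x))"
      by (intro mult_right_mono sum_nonneg S) auto
    also have "\<dots> \<le> \<bar>C\<bar> * (\<Sum>m\<in>?I. M)" by (intro mult_left_mono sum_mono S) auto
    finally show ?thesis by simp
  qed
  then show ?thesis by blast
qed

lemma distribution_linear:
  assumes "T \<in> distributions \<Omega>" "compact K" "K \<subseteq> \<Omega>"
  shows "linear_functional_on (test_in K) T"
  using assms test_in_subset[OF assms(2,3)] unfolding distributions_def linear_functional_on_def by blast

lemma regular_integrable:
  assumes "continuous_on \<Omega> f" "compact K" "K \<subseteq> \<Omega>" "\<phi> \<in> test_in K"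
  shows "set_integrable lborel \<Omega> (\<lambda>x. f x * \<phi> x)"
    and "regular_distr \<Omega> f \<phi> = (LINT x|lborel. indicator K x *\<^sub>R (f x * \<phi> x))"
proof -
  have eq: "(\<lambda>x. indicator \<Omega> x *\<^sub>R (f x * \<phi> x)) = (\<lambda>x. indicator K x *\<^sub>R (f x * \<phi> x))"
    using assms(3) test_inD(3)[OF assms(4)] by (force simp: indicator_def)
  have "continuous_on K (\<lambda>x. f x * \<phi> x)"
    using assms Ck_on_continuous[OF test_inD(2)[OF assms(4)]]
    by (intro continuous_on_mult) (auto intro: continuous_on_subset)
  then show "set_integrable lborel \<Omega> (\<lambda>x. f x * \<phi> x)"
    unfolding set_integrable_def eq by (rule borel_integrable_compact[OF assms(2)])
  show "regular_distr \<Omega> f \<phi> = (LINT x|lborel. indicator K x *\<^sub>R (f x * \<phi> x))"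
    unfolding regular_distr_def set_lebesgue_integral_def eq ..
qed

lemma regular_distr_linear:
  assumes "continuous_on \<Omega> f" "compact K" "K \<subseteq> \<Omega>"
  shows "linear_functional_on (test_in K) (regular_distr \<Omega> f)"
  unfolding linear_functional_on_def
proof (intro conjI ballI allI)
  fix \<phi> \<psi> assume "\<phi> \<in> test_in K" "\<psi> \<in> test_in K"
  then show "regular_distr \<Omega> f (\<lambda>x. \<phi> x + \<psi> x) = regular_distr \<Omega> f \<phi> + regular_distr \<Omega> f \<psi>"
    using set_integral_add(2)[OF regular_integrable(1)[OF assms] regular_integrable(1)[OF assms]]
    unfolding regular_distr_def by (simp add: distrib_left)
next
  fix c \<phi>
  show "regular_distr \<Omega> f (\<lambda>x. c * \<phi> x) = c * regular_distr \<Omega> f \<phi>"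
    unfolding regular_distr_def set_lebesgue_integral_def
    by (simp add: mult.left_commute[of _ c] flip: integral_mult_right_zero)
qed

lemma regular_distr_estimate:
  assumes "continuous_on \<Omega> f" "compact K" "K \<subseteq> \<Omega>"
  shows "\<exists>C. \<forall>\<phi>\<in>test_in K. \<forall>M. derivs_le 0 UNIV \<phi> M \<longrightarrow> norm (regular_distr \<Omega> f \<phi>) \<le> C * M"
proof -
  have "compact (f ` K)" using assms by (intro compact_continuous_image) (auto intro: continuous_on_subset)
  then obtain B where B: "\<And>x. x \<in> K \<Longrightarrow> norm (f x) \<le> B" by (meson bounded_iff compact_imp_bounded imageI)
  have intK: "integrable lborel (\<lambda>x. indicator K x *\<^sub>R (1::real))"
    by (rule borel_integrable_compact[OF assms(2)]) simp
  have "norm (regular_distr \<Omega> f \<phi>) \<le> (B * (LINT x|lborel. indicator K x *\<^sub>R (1::real))) * M"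
    if \<phi>: "\<phi> \<in> test_in K" "derivs_le 0 UNIV \<phi> M" for \<phi> M
  proof -
    have int: "integrable lborel (\<lambda>x. indicator K x *\<^sub>R (f x * \<phi> x))"
      using assms Ck_on_continuous[OF test_inD(2)[OF \<phi>(1)]]
      by (intro borel_integrable_compact continuous_on_mult) (auto intro: continuous_on_subset)
    have "norm (f x * \<phi> x) \<le> B * M" if "x \<in> K" for x
      using B[OF that] derivs_le_norm[OF \<phi>(2)] order_trans[OF norm_ge_zero B[OF that]]
      unfolding norm_mult by (intro mult_mono) auto
    then have le: "norm (indicator K x *\<^sub>R (f x * \<phi> x)) \<le> (B * M) * (indicator K x *\<^sub>R (1::real))" for x
      by (simp add: indicator_def)
    have "norm (regular_distr \<Omega> f \<phi>) \<le> (LINT x|lborel. (B * M) * (indicator K x *\<^sub>R (1::real)))"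
      unfolding regular_integrable(2)[OF assms \<phi>(1)]
      by (rule order_trans[OF integral_norm_bound])
        (intro integral_mono integrable_norm int integrable_mult_right intK le)
    then show ?thesis by (simp add: mult_ac)
  qed
  then show ?thesis by blast
qed

text \<open>The rate of convergence holds uniformly for all test functions that vanish off \<open>K\<close> and have
  derivatives up to some order bounded by \<open>M\<close>: the uniform boundedness principle is applied to
  \<open>(T - f\<^sub>n) / R(n)\<close>, with the index shifted because \<open>f\<^sub>0\<close> is arbitrary.\<close>

lemma uniform_convergence_rate:
  fixes \<Omega> :: "'a::euclidean_space set"
  assumes T: "T \<in> distributions \<Omega>" and K: "compact K" "K \<subseteq> \<Omega>"
    and f: "\<And>n. 1 \<le> n \<Longrightarrow> continuous_on \<Omega> (f n)"
    and R: "\<And>n. 1 \<le> n \<Longrightarrow> R n > 0" and rate: "convergence_rate \<Omega> T f R"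
  shows "\<exists>C N. \<forall>n\<ge>1. \<forall>\<phi>\<in>test_in K. \<forall>M. derivs_le N UNIV \<phi> M \<longrightarrow>
    norm (T \<phi> - regular_distr \<Omega> (f n) \<phi>) \<le> C * R n * M"
proof -
  define U where "U n \<phi> = (T \<phi> - regular_distr \<Omega> (f (Suc n)) \<phi>) / of_real (R (Suc n))" for n \<phi>
  have fS: "continuous_on \<Omega> (f (Suc n))" and RS: "R (Suc n) > 0" for n using f R by auto
  have lin: "linear_functional_on (test_in K) (U n)" for n
    using distribution_linear[OF T K] regular_distr_linear[OF fS K, of n]
    unfolding linear_functional_on_def U_def by (simp add: diff_divide_distrib add_divide_distrib right_diff_distrib)
  have cont: "\<exists>C N. \<forall>\<phi>\<in>test_in K. \<forall>M. derivs_le N UNIV \<phi> M \<longrightarrow> norm (U n \<phi>) \<le> C * M" for n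
  proof -
    obtain C1 N where C1: "\<And>\<phi> M. \<phi> \<in> test_in K \<Longrightarrow> derivs_le N UNIV \<phi> M \<Longrightarrow> norm (T \<phi>) \<le> C1 * M"
      using distribution_estimate[OF T K] by blast
    obtain C2 where C2: "\<And>\<phi> M. \<phi> \<in> test_in K \<Longrightarrow> derivs_le 0 UNIV \<phi> M \<Longrightarrow> norm (regular_distr \<Omega> (f (Suc n)) \<phi>) \<le> C2 * M"
      using regular_distr_estimate[OF fS K] by blast
    have "norm (U n \<phi>) \<le> ((C1 + C2) / R (Suc n)) * M" if \<phi>: "\<phi> \<in> test_in K" "derivs_le N UNIV \<phi> M" for \<phi> M
    proof -
      have "derivs_le 0 UNIV \<phi> M" using \<phi>(2) by (rule derivs_le_mono) auto
      then have "norm (T \<phi> - regular_distr \<Omega> (f (Suc n)) \<phi>) \<le> C1 * M + C2 * M"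
        using C1[OF \<phi>] C2[OF \<phi>(1)] norm_triangle_ineq4[of "T \<phi>" "regular_distr \<Omega> (f (Suc n)) \<phi>"] by force
      then show ?thesis using RS[of n] by (simp add: U_def norm_divide field_simps)
    qed
    then show ?thesis by blast
  qed
  have bdd: "\<exists>B. \<forall>n. norm (U n \<phi>) \<le> B" if "\<phi> \<in> test_in K" for \<phi>
  proof -
    have "(\<lambda>n. norm (T \<phi> - regular_distr \<Omega> (f n) \<phi>)) \<in> O(R)"
      using rate that test_in_subset[OF K] unfolding convergence_rate_def by blast
    from bigo_uniform[OF this R] obtain C where
      C: "\<And>n. 1 \<le> n \<Longrightarrow> norm (T \<phi> - regular_distr \<Omega> (f n) \<phi>) \<le> C * R n" by auto
    have "norm (U n \<phi>) \<le> C" for n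
      using C[of "Suc n"] RS[of n] by (simp add: U_def norm_divide field_simps)
    then show ?thesis by blast
  qed
  obtain C N where CN: "\<And>n \<phi> M. \<phi> \<in> test_in K \<Longrightarrow> derivs_le N UNIV \<phi> M \<Longrightarrow> norm (U n \<phi>) \<le> C * M"
    using uniform_boundedness_test_in[of K U, OF lin cont bdd] by blast
  have "norm (T \<phi> - regular_distr \<Omega> (f n) \<phi>) \<le> C * R n * M"
    if "1 \<le> n" "\<phi> \<in> test_in K" "derivs_le N UNIV \<phi> M" for n \<phi> M
  proof -
    obtain n' where n': "n = Suc n'" using \<open>1 \<le> n\<close> by (cases n) auto
    show ?thesis using CN[OF that(2,3), of n'] RS[of n'] unfolding n' by (simp add: U_def norm_divide field_simps)
  qed
  then show ?thesis by blast
qed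

lemma E_class_derivs_le:
  fixes \<Omega> :: "'a::euclidean_space set"
  assumes "open \<Omega>" "f \<in> E_class k s \<Omega>" "compact K" "K \<subseteq> \<Omega>"
  shows "\<exists>C\<ge>0. \<forall>n\<ge>1. derivs_le k K (f n) (C * real n powr s)"
proof (cases "K = {}")
  case True
  then show ?thesis by (auto simp: derivs_le_def)
next
  case False
  let ?I = "{m. m \<in> multi_indices \<and> order_mi (m :: 'a \<Rightarrow> nat) \<le> k}"
  have f: "Ck_on k \<Omega> (f n)" if "1 \<le> n" for n using assms(2) that by (auto simp: E_class_def)
  have "compactly_inside K \<Omega>"
    using assms(3,4) compact_imp_closed[OF assms(3)] by (simp add: compactly_inside_def closure_closed)
  then have O: "(\<lambda>n. SUP x\<in>K. norm (mi_deriv m (f n) x)) \<in> O(\<lambda>n. real n powr s)" if "m \<in> ?I" for m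
    using assms(2) False that by (auto simp: E_class_def)
  have "\<forall>m\<in>?I. \<exists>C\<ge>0. \<forall>n\<ge>1. \<bar>SUP x\<in>K. norm (mi_deriv m (f n) x)\<bar> \<le> C * real n powr s"
    by (intro ballI bigo_uniform[OF O]) auto
  from bchoice[OF this] obtain C where
    "\<forall>m\<in>?I. C m \<ge> 0 \<and> (\<forall>n\<ge>1. \<bar>SUP x\<in>K. norm (mi_deriv m (f n) x)\<bar> \<le> C m * real n powr s)" by blast
  then have C: "\<And>m. m \<in> ?I \<Longrightarrow> C m \<ge> 0"
    "\<And>m n. m \<in> ?I \<Longrightarrow> 1 \<le> n \<Longrightarrow> \<bar>SUP x\<in>K. norm (mi_deriv m (f n) x)\<bar> \<le> C m * real n powr s" by auto
  have "derivs_le k K (f n) ((\<Sum>m\<in>?I. C m) * real n powr s)" if n: "1 \<le> n" for n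
  proof (rule derivs_le_of_mi_deriv[OF assms(1) f[OF n] assms(4)])
    fix m :: "'a \<Rightarrow> nat" and x assume m: "m \<in> multi_indices" "order_mi m \<le> k" and x: "x \<in> K"
    obtain M where M: "derivs_le k K (f n) M" using derivs_le_compact[OF assms(3,4) f[OF n]] by blast
    have "norm (mi_deriv m (f n) x) \<le> (SUP x\<in>K. norm (mi_deriv m (f n) x))"
      using norm_mi_deriv_le[OF M m(2)] by (intro cSUP_upper x bdd_aboveI2)
    also have "\<dots> \<le> C m * real n powr s" using C(2)[of m n] m n by simp
    also have "\<dots> \<le> (\<Sum>m\<in>?I. C m) * real n powr s"
      using m C(1) finite_multi_indices by (intro mult_right_mono member_le_sum) auto
    finally show "norm (mi_deriv m (f n) x) \<le> (\<Sum>m\<in>?I. C m) * real n powr s" .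
  qed
  moreover have "(\<Sum>m\<in>?I. C m) \<ge> 0" using C(1) by (intro sum_nonneg) auto
  ultimately show ?thesis by blast
qed

text \<open>By the Leibniz rule, the derivatives of \<open>\<rho> \<phi>\<close> are controlled by those of \<open>\<phi>\<close>, so the Schwartz seminorms
  with trivial weight suffice.\<close>

lemma mult_distr_tempered:
  fixes \<Omega> :: "'a::euclidean_space set"
  assumes T: "T \<in> distributions \<Omega>" and \<rho>: "\<rho> \<in> test_functions \<Omega>"
  shows "mult_distr \<rho> T \<in> tempered_distributions"
proof -
  define K where "K = supp \<rho>"
  have K: "compact K" "K \<subseteq> \<Omega>" and \<rho>K: "\<rho> \<in> test_in K"
    using \<rho> test_functions_in[OF \<rho>] by (auto simp: K_def test_functions_def)
  have in_K: "(\<lambda>x. \<rho> x * \<phi> x) \<in> test_in K" if "\<phi> \<in> schwartz_functions" for \<phi>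
    using test_in_mult_smooth[OF \<rho>K] that by (auto simp: schwartz_functions_def)
  have lin: "linear_functional_on schwartz_functions (mult_distr \<rho> T)"
    using distribution_linear[OF T K] in_K
    unfolding linear_functional_on_def mult_distr_def
    by (simp add: distrib_left mult.left_commute[of "\<rho> _"])
  obtain C N where C: "\<And>\<phi> M. \<phi> \<in> test_in K \<Longrightarrow> derivs_le N UNIV \<phi> M \<Longrightarrow> norm (T \<phi>) \<le> C * M"
    using distribution_estimate[OF T K] by blast
  obtain A where A: "derivs_le N UNIV \<rho> A" using test_in_derivs_le[OF K(1) \<rho>K] by blast
  have A0: "0 \<le> A" using derivs_le_nonneg[OF A] by blast
  let ?I = "{m. m \<in> multi_indices \<and> order_mi (m :: 'a \<Rightarrow> nat) \<le> N}"
  have "norm (mult_distr \<rho> T \<phi>) \<le> (\<bar>C\<bar> * (2 ^ N * A)) *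
      (\<Sum>\<alpha>\<in>?I. \<Sum>m\<in>?I. SUP x. norm (of_real (monomial \<alpha> x) * mi_deriv m \<phi> x))"
    if \<phi>: "\<phi> \<in> schwartz_functions" for \<phi>
  proof -
    define p where "p \<alpha> = (\<Sum>m\<in>?I. SUP x. norm (of_real (monomial \<alpha> x) * mi_deriv m \<phi> x))" for \<alpha>
    have p0: "0 \<le> p \<alpha>" if "\<alpha> \<in> ?I" for \<alpha>
      unfolding p_def using that
      by (intro sum_nonneg) (auto intro!: cSUP_upper2[OF schwartz_bdd[OF \<phi>] UNIV_I norm_ge_zero])
    have zero: "(\<lambda>_. 0) \<in> ?I" by (simp add: zero_multi_index)
    have M: "derivs_le N UNIV \<phi> (p (\<lambda>_. 0))"
      using schwartz_derivs_le[OF \<phi>, of N] by (simp add: p_def zero_multi_index)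
    have "norm (mult_distr \<rho> T \<phi>) \<le> C * (2 ^ N * A * p (\<lambda>_. 0))"
      unfolding mult_distr_def
      by (intro C in_K[OF \<phi>] derivs_le_mult[OF open_UNIV subset_UNIV test_inD(2)[OF \<rho>K] schwartz_smooth[OF \<phi>] A M])
    also have "\<dots> \<le> \<bar>C\<bar> * (2 ^ N * A * p (\<lambda>_. 0))"
      using A0 derivs_le_nonneg[OF M] by (intro mult_right_mono mult_nonneg_nonneg) auto
    also have "\<dots> = (\<bar>C\<bar> * (2 ^ N * A)) * p (\<lambda>_. 0)" by (simp add: mult_ac)
    also have "\<dots> \<le> (\<bar>C\<bar> * (2 ^ N * A)) * (\<Sum>\<alpha>\<in>?I. p \<alpha>)"
      using A0 p0 finite_multi_indices zero
      by (intro mult_left_mono member_le_sum) auto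
    finally show ?thesis unfolding p_def .
  qed
  then show ?thesis using lin unfolding tempered_distributions_def by blast
qed

section \<open>The Zygmund estimate\<close>

lemma dyadic_eq:
  "dyadic \<theta>\<^sub>1 \<theta> j = (\<lambda>x. of_real (2 ^ (j * DIM('a))) * (if j = 0 then \<theta>\<^sub>1 else \<theta>) (2 ^ j *\<^sub>R (x :: 'a::euclidean_space)))"
  by (auto simp: dyadic_def)

text \<open>The test functions \<open>y \<mapsto> \<rho>(y) \<theta>\<^sub>j(x - y)\<close> grow at most exponentially in \<open>j\<close>, uniformly in \<open>x\<close>.\<close>

lemma dyadic_test_functions:
  fixes \<rho> :: "'a::euclidean_space \<Rightarrow> complex"
  assumes K: "compact K" "\<rho> \<in> test_in K" and \<theta>: "\<theta>\<^sub>1 \<in> schwartz_functions" "\<theta> \<in> schwartz_functions"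
  shows "(\<lambda>y. \<rho> y * dyadic \<theta>\<^sub>1 \<theta> j (x - y)) \<in> test_in K"
    and "\<exists>B\<ge>0. \<forall>j x. derivs_le N UNIV (\<lambda>y. \<rho> y * dyadic \<theta>\<^sub>1 \<theta> j (x - y)) (B * 2 ^ (j * (DIM('a) + N)))"
proof -
  define \<psi> where "\<psi> j = (if j = 0 then \<theta>\<^sub>1 else \<theta>)" for j :: nat
  have \<psi>: "\<psi> j \<in> schwartz_functions" for j using \<theta> by (simp add: \<psi>_def)
  have eq: "dyadic \<theta>\<^sub>1 \<theta> j (x - y) = of_real (2 ^ (j * DIM('a))) * \<psi> j (2 ^ j *\<^sub>R x + (- (2 ^ j)) *\<^sub>R y)" for j x y
    unfolding dyadic_eq \<psi>_def by (simp add: algebra_simps)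
  have C: "Ck_on k UNIV (\<lambda>y. \<psi> j (2 ^ j *\<^sub>R x + (- (2 ^ j)) *\<^sub>R y))" for j k x
    by (rule Ck_on_affine[OF schwartz_smooth[OF \<psi>]])
  show "(\<lambda>y. \<rho> y * dyadic \<theta>\<^sub>1 \<theta> j (x - y)) \<in> test_in K"
    unfolding eq by (intro test_in_mult_smooth[OF K(2)]) (unfold smooth_on_def, intro allI Ck_on_cmult C open_UNIV)
  obtain A where A: "derivs_le N UNIV \<rho> A" using test_in_derivs_le[OF K] by blast
  obtain D1 D2 where D: "derivs_le N UNIV \<theta>\<^sub>1 D1" "derivs_le N UNIV \<theta> D2"
    using schwartz_derivs_le \<theta> by blast
  have nonneg: "0 \<le> A" "0 \<le> D1" "0 \<le> D2" using derivs_le_nonneg A D by blast+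
  have \<psi>D: "derivs_le N UNIV (\<psi> j) (D1 + D2)" for j
    unfolding \<psi>_def using D nonneg by (auto intro: derivs_le_mono)
  have "derivs_le N UNIV (\<lambda>y. \<rho> y * dyadic \<theta>\<^sub>1 \<theta> j (x - y)) ((2 ^ N * A * (D1 + D2)) * 2 ^ (j * (DIM('a) + N)))" for j x
  proof -
    have "derivs_le N UNIV (\<lambda>y. \<psi> j (2 ^ j *\<^sub>R x + (- (2 ^ j)) *\<^sub>R y)) (\<bar>- (2 ^ j)\<bar> ^ N * (D1 + D2))"
      by (rule derivs_le_affine[OF schwartz_smooth[OF \<psi>] \<psi>D]) simp
    then have "derivs_le N UNIV (\<lambda>y. \<rho> y * dyadic \<theta>\<^sub>1 \<theta> j (x - y))
        (2 ^ N * A * (norm (of_real (2 ^ (j * DIM('a))) :: complex) * (\<bar>- (2 ^ j)\<bar> ^ N * (D1 + D2))))"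
      unfolding eq
      by (intro derivs_le_mult[OF open_UNIV subset_UNIV test_inD(2)[OF K(2)] _ A] derivs_le_cmult Ck_on_cmult C open_UNIV)
    note 1 = this
    have 2: "norm (of_real (2 ^ (j * DIM('a))) :: complex) * (\<bar>- (2 ^ j)\<bar> ^ N * (D1 + D2))
        = (D1 + D2) * 2 ^ (j * (DIM('a) + N))"
      unfolding norm_of_real by (simp add: power_add distrib_left mult_ac flip: power_mult)
    show ?thesis using 1 unfolding 2 by (simp only: mult_ac)
  qed
  then show "\<exists>B\<ge>0. \<forall>j x. derivs_le N UNIV (\<lambda>y. \<rho> y * dyadic \<theta>\<^sub>1 \<theta> j (x - y)) (B * 2 ^ (j * (DIM('a) + N)))"
    using nonneg by (intro exI[of _ "2 ^ N * A * (D1 + D2)"]) auto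
qed

text \<open>The integral of \<open>f\<^sub>n \<rho>\<close> against \<open>\<theta>\<^sub>j(x - y)\<close>. Extended by zero, \<open>f\<^sub>n \<rho>\<close> is of class \<open>C\<^sup>k\<close> on the whole space,
  and its derivatives up to order \<open>k\<close> are \<open>O(n\<^sup>s)\<close> uniformly. The substitution \<open>y = x - 2\<^sup>-\<^sup>j z\<close> turns the integral into an
  average at scale \<open>2\<^sup>-\<^sup>j\<close>.\<close>

lemma regular_part_estimate:
  fixes \<Omega> :: "'a::euclidean_space set"
  assumes \<Omega>: "open \<Omega>" and f: "f \<in> E_class k s \<Omega>" and \<rho>: "\<rho> \<in> test_functions \<Omega>" and lk: "l \<le> k"
    and \<theta>: "\<theta> \<in> schwartz_functions"
    and mom: "\<And>m. m \<in> multi_indices \<Longrightarrow> order_mi m < l \<Longrightarrow> (LINT z|lborel. of_real (monomial m z) * \<theta> z) = 0"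
  shows "\<exists>C\<ge>0. \<forall>n\<ge>1. \<forall>j\<ge>1. \<forall>x. norm (regular_distr \<Omega> (f n) (\<lambda>y. \<rho> y * dyadic \<theta>\<^sub>1 \<theta> j (x - y)))
    \<le> C * real n powr s * (1/2) ^ (j * l)"
proof -
  define K where "K = supp \<rho>"
  have K: "compact K" "K \<subseteq> \<Omega>" and \<rho>K: "\<rho> \<in> test_in K"
    using \<rho> test_functions_in[OF \<rho>] by (auto simp: K_def test_functions_def)
  have fk: "Ck_on k \<Omega> (f n)" if "1 \<le> n" for n using f that by (auto simp: E_class_def)
  obtain A where A: "derivs_le k UNIV \<rho> A" using test_in_derivs_le[OF K(1) \<rho>K] by blast
  have A0: "0 \<le> A" using derivs_le_nonneg[OF A] by blast
  obtain B where B: "0 \<le> B" "\<And>n. 1 \<le> n \<Longrightarrow> derivs_le k K (f n) (B * real n powr s)"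
    using E_class_derivs_le[OF \<Omega> f K] by blast
  define I where "I = (LINT z|lborel. norm z ^ l * norm (\<theta> z))"
  have I0: "0 \<le> I" unfolding I_def by (rule Bochner_Integration.integral_nonneg) simp
  define C where "C = DIM('a) ^ l * I * (2 ^ k * B * A)"
  have "norm (regular_distr \<Omega> (f n) (\<lambda>y. \<rho> y * dyadic \<theta>\<^sub>1 \<theta> j (x - y))) \<le> C * real n powr s * (1/2) ^ (j * l)"
    if n: "1 \<le> n" and j: "1 \<le> j" for n j x
  proof -
    define g where "g y = f n y * \<rho> y" for y
    define M where "M = 2 ^ k * (B * real n powr s) * A"
    have M0: "0 \<le> M" using A0 B(1) by (simp add: M_def)
    have gout: "g y = 0" if "y \<notin> K" for y using test_inD(3)[OF \<rho>K that] by (simp add: g_def)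
    have oK: "open (- K)" using compact_imp_closed[OF K(1)] by blast
    have "Ck_on k \<Omega> g"
      unfolding g_def by (intro Ck_on_mult \<Omega> fk n Ck_on_subset[OF test_inD(2)[OF \<rho>K]]) auto
    moreover have "Ck_on k (- K) g"
      using Ck_on_const[of k "- K" 0] gout by (subst Ck_on_cong[OF oK, of g "\<lambda>_. 0"]) auto
    ultimately have "Ck_on k (\<Omega> \<union> - K) g" by (intro Ck_on_Un \<Omega> oK)
    moreover have "\<Omega> \<union> - K = UNIV" using K by blast
    ultimately have gC: "Ck_on k UNIV g" by simp
    have "derivs_le k K g M"
      unfolding g_def M_def
      by (intro derivs_le_mult[OF \<Omega> K(2) fk[OF n]] Ck_on_subset[OF test_inD(2)[OF \<rho>K]] B(2) n
          derivs_le_subset[OF A]) auto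
    moreover have "derivs_le k (- K) g M" using gout M0 by (intro derivs_le_outside oK) auto
    ultimately have "derivs_le k (K \<union> - K) g M" by (rule derivs_le_Un)
    then have gM: "derivs_le l UNIV g M" using derivs_le_mono[OF _ lk order_refl] by simp
    have gl: "Ck_on l UNIV g" by (rule Ck_on_mono[OF gC lk])
    define h where "h y = g y * (of_real (2 ^ (j * DIM('a))) * \<theta> (2 ^ j *\<^sub>R (x - y)))" for y
    define c where "c = - ((1/2::real) ^ j)"
    have c: "c \<noteq> 0" "\<bar>c\<bar> = (1/2) ^ j" by (auto simp: c_def)
    have "continuous_on UNIV (\<lambda>y. \<theta> (2 ^ j *\<^sub>R (x - y)))"
      by (rule continuous_on_compose2[OF Ck_on_continuous[OF schwartz_smooth[OF \<theta>, of 0]]])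
        (auto intro!: continuous_intros)
    then have hm: "h \<in> borel_measurable borel"
      unfolding h_def[abs_def]
      by (intro borel_measurable_continuous_onI continuous_on_mult continuous_on_const Ck_on_continuous[OF gC])
    have hx: "h (x + c *\<^sub>R z) = of_real (2 ^ (j * DIM('a))) * (g (x + c *\<^sub>R z) * \<theta> z)" for z
    proof -
      have "2 ^ j *\<^sub>R (x - (x + c *\<^sub>R z)) = z" by (simp add: c_def power_one_over)
      then show ?thesis by (simp add: h_def mult_ac)
    qed
    have "regular_distr \<Omega> (f n) (\<lambda>y. \<rho> y * dyadic \<theta>\<^sub>1 \<theta> j (x - y)) = (LINT y|lborel. h y)"
      unfolding regular_distr_def set_lebesgue_integral_def
    proof (rule Bochner_Integration.integral_cong[OF refl])
      fix y
      show "indicator \<Omega> y *\<^sub>R (f n y * (\<rho> y * dyadic \<theta>\<^sub>1 \<theta> j (x - y))) = h y"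
      proof (cases "y \<in> K")
        case True
        then show ?thesis using K j by (auto simp: h_def g_def dyadic_def)
      next
        case False
        then show ?thesis using test_inD(3)[OF \<rho>K False] by (simp add: h_def g_def)
      qed
    qed
    also have "\<dots> = of_real (\<bar>c\<bar> ^ DIM('a)) * (LINT z|lborel. h (x + c *\<^sub>R z))"
      by (rule integral_lborel_affine[OF hm c(1)])
    also have "\<dots> = of_real (\<bar>c\<bar> ^ DIM('a)) * (of_real (2 ^ (j * DIM('a))) * (LINT z|lborel. g (x + c *\<^sub>R z) * \<theta> z))"
      unfolding hx by simp
    also have "\<dots> = of_real (\<bar>c\<bar> ^ DIM('a) * 2 ^ (j * DIM('a))) * (LINT z|lborel. g (x + c *\<^sub>R z) * \<theta> z)"
      by (simp only: of_real_mult mult.assoc)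
    also have "\<bar>c\<bar> ^ DIM('a) * 2 ^ (j * DIM('a)) = 1"
      unfolding c(2) power_mult power_mult_distrib[symmetric] by (simp add: power_one_over)
    finally have "norm (regular_distr \<Omega> (f n) (\<lambda>y. \<rho> y * dyadic \<theta>\<^sub>1 \<theta> j (x - y)))
        = norm (LINT z|lborel. g (x + c *\<^sub>R z) * \<theta> z)" by simp
    also have "\<dots> \<le> DIM('a) ^ l * I * (\<bar>c\<bar> ^ l * M)"
      unfolding I_def by (rule vanishing_moments_estimate[OF gl gM \<theta> mom])
    also have "\<dots> = C * real n powr s * (1/2) ^ (j * l)"
      unfolding C_def M_def c(2) by (simp add: power_mult mult_ac)
    finally show ?thesis .
  qed
  moreover have "C \<ge> 0" using I0 A0 B(1) by (simp add: C_def)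
  ultimately show ?thesis by blast
qed

text \<open>For \<open>n\<close> about \<open>2 powr (\<delta> j / s)\<close>, the factor \<open>n\<^sup>s\<close> uses up exactly the gain \<open>2 powr (\<delta> j)\<close> of
  the smooth part, and the condition on \<open>b\<close> makes \<open>n powr (- b)\<close> compensate the growth of the other part.\<close>

lemma balance_index:
  fixes s b \<beta> Q \<delta> :: real
  assumes "s > 0" "b > 0" "\<delta> > 0" "s * (Q + \<beta>) \<le> b * \<delta>"
  shows "\<exists>n\<ge>1. 2 powr (\<beta> * real j) * (real n powr s * 2 powr (- (\<beta> + \<delta>) * real j)) \<le> 2 powr s
    \<and> 2 powr (\<beta> * real j) * (2 powr (Q * real j) * real n powr (- b)) \<le> 1"
proof -
  define u where "u = \<delta> * real j / s"
  define n where "n = nat \<lceil>2 powr u\<rceil>"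
  have u0: "u \<ge> 0" using assms by (simp add: u_def)
  have p1: "1 \<le> 2 powr u" using u0 by (simp add: ge_one_powr_ge_zero)
  have n1: "2 powr u \<le> real n" unfolding n_def by linarith
  have n2: "real n \<le> 2 * 2 powr u" using p1 unfolding n_def by linarith
  have n: "n \<ge> 1" using n1 p1 by linarith
  have "real n powr s \<le> (2 * 2 powr u) powr s" using n2 assms by (intro powr_mono2) auto
  also have "\<dots> = 2 powr s * 2 powr (\<delta> * real j)"
    using assms by (simp add: powr_mult powr_powr u_def)
  finally have "2 powr (\<beta> * real j) * (real n powr s * 2 powr (- (\<beta> + \<delta>) * real j))
      \<le> 2 powr (\<beta> * real j) * ((2 powr s * 2 powr (\<delta> * real j)) * 2 powr (- (\<beta> + \<delta>) * real j))"
    by (intro mult_left_mono mult_right_mono) auto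
  also have "\<dots> = 2 powr s" by (simp flip: powr_add add: algebra_simps)
  finally have 1: "2 powr (\<beta> * real j) * (real n powr s * 2 powr (- (\<beta> + \<delta>) * real j)) \<le> 2 powr s" .
  have "real n powr (- b) \<le> (2 powr u) powr (- b)"
    using n1 p1 assms by (intro powr_mono2') auto
  then have "2 powr (\<beta> * real j) * (2 powr (Q * real j) * real n powr (- b))
     \<le> 2 powr (\<beta> * real j) * (2 powr (Q * real j) * (2 powr u) powr (- b))"
    by (intro mult_left_mono) auto
  also have "\<dots> = 2 powr ((Q + \<beta>) * real j - b * u)"
    by (simp add: powr_powr algebra_simps flip: powr_add)
  also have "\<dots> \<le> 2 powr 0"
  proof (rule powr_mono)
    have "(Q + \<beta>) * real j \<le> (b * \<delta> / s) * real j"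
      using assms by (intro mult_right_mono) (auto simp: field_simps)
    then show "(Q + \<beta>) * real j - b * u \<le> 0" by (simp add: u_def)
  qed simp
  finally show ?thesis using 1 n by auto
qed

text \<open>Both pairs of conditions provide a growth exponent \<open>s\<close> and a rate exponent \<open>b\<close> that satisfy the condition
  of \<open>balance_index\<close> with \<open>Q = d + N\<close>. The order \<open>N\<close> comes from the uniform boundedness principle and depends on
  the given rate; it must be known before \<open>s\<close>, respectively \<open>b\<close>, is chosen.\<close>

lemma rate_exponents:
  fixes \<Omega> :: "'a::euclidean_space set"
  assumes T: "T \<in> distributions \<Omega>" and K: "compact K" "K \<subseteq> \<Omega>"
    and f: "\<And>n. 1 \<le> n \<Longrightarrow> continuous_on \<Omega> (f n)"
    and hyp: "((\<forall>a>0. f \<in> E_class k a \<Omega>) \<and>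
          (\<exists>b>0. convergence_rate \<Omega> T f (\<lambda>n. real n powr (- b))))
       \<or> ((\<exists>s>0. f \<in> E_class k s \<Omega>) \<and>
          (\<exists>R. (\<forall>n. R n \<ge> 0) \<and> rapidly_decreasing R \<and> convergence_rate \<Omega> T f R))"
    and \<delta>: "\<delta> > 0"
  shows "\<exists>s b C N. s > 0 \<and> b > 0 \<and> C \<ge> 0 \<and> f \<in> E_class k s \<Omega> \<and> s * (real (DIM('a) + N) + \<beta>) \<le> b * \<delta> \<and>
    (\<forall>n\<ge>1. \<forall>\<phi>\<in>test_in K. \<forall>M. derivs_le N UNIV \<phi> M \<longrightarrow>
      norm (T \<phi> - regular_distr \<Omega> (f n) \<phi>) \<le> C * real n powr (- b) * M)"
  using hyp
proof (elim disjE conjE exE)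
  fix b :: real
  assume E: "\<forall>a>0. f \<in> E_class k a \<Omega>" and b: "b > 0" and rate: "convergence_rate \<Omega> T f (\<lambda>n. real n powr (- b))"
  obtain C N where C: "\<And>n \<phi> M. 1 \<le> n \<Longrightarrow> \<phi> \<in> test_in K \<Longrightarrow> derivs_le N UNIV \<phi> M \<Longrightarrow>
      norm (T \<phi> - regular_distr \<Omega> (f n) \<phi>) \<le> C * real n powr (- b) * M"
    using uniform_convergence_rate[OF T K f _ rate] by fastforce
  define q where "q = \<bar>real (DIM('a) + N) + \<beta>\<bar> + 1"
  define s where "s = b * \<delta> / q"
  have q: "q > 0" by (simp add: q_def)
  have s: "s > 0" using b \<delta> q by (simp add: s_def)
  have "s * (real (DIM('a) + N) + \<beta>) \<le> s * q" using s by (intro mult_left_mono) (auto simp: q_def)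
  also have "\<dots> = b * \<delta>" using q by (simp add: s_def)
  finally have 1: "s * (real (DIM('a) + N) + \<beta>) \<le> b * \<delta>" .
  have "norm (T \<phi> - regular_distr \<Omega> (f n) \<phi>) \<le> \<bar>C\<bar> * real n powr (- b) * M"
    if "1 \<le> n" "\<phi> \<in> test_in K" "derivs_le N UNIV \<phi> M" for n \<phi> M
    using derivs_le_nonneg[OF that(3)] by (intro order_trans[OF C[OF that]] mult_right_mono) auto
  then show ?thesis using s b E 1
    by (intro exI[of _ s] exI[of _ b] exI[of _ "\<bar>C\<bar>"] exI[of _ N]) auto
next
  fix s :: real and R :: "nat \<Rightarrow> real"
  assume s: "s > 0" and E: "f \<in> E_class k s \<Omega>" and R0: "\<forall>n. R n \<ge> 0" and R: "rapidly_decreasing R"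
    and rate: "convergence_rate \<Omega> T f R"
  \<comment> \<open>\<open>R\<close> may vanish, but the uniform boundedness principle needs a rate to divide by\<close>
  define R' where "R' n = R n + (1/2) ^ n" for n
  have R'0: "R' n > 0" for n using R0 by (simp add: R'_def add_nonneg_pos)
  have "R \<in> O(R')" using R0 by (intro landau_o.big_mono always_eventually) (auto simp: R'_def)
  then have rate': "convergence_rate \<Omega> T f R'"
    using rate landau_o.big_trans unfolding convergence_rate_def by blast
  obtain C N where C: "\<And>n \<phi> M. 1 \<le> n \<Longrightarrow> \<phi> \<in> test_in K \<Longrightarrow> derivs_le N UNIV \<phi> M \<Longrightarrow>
      norm (T \<phi> - regular_distr \<Omega> (f n) \<phi>) \<le> C * R' n * M"
    using uniform_convergence_rate[OF T K f R'0 rate'] by blast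
  define q where "q = \<bar>real (DIM('a) + N) + \<beta>\<bar> + 1"
  define b where "b = s * q / \<delta>"
  have q: "q > 0" by (simp add: q_def)
  have b: "b > 0" using s \<delta> q by (simp add: b_def)
  have "s * (real (DIM('a) + N) + \<beta>) \<le> s * q" using s by (intro mult_left_mono) (auto simp: q_def)
  also have "\<dots> = b * \<delta>" using \<delta> by (simp add: b_def)
  finally have 1: "s * (real (DIM('a) + N) + \<beta>) \<le> b * \<delta>" .
  have "(\<lambda>n. (1/2::real) ^ n) \<in> O(\<lambda>n. real n powr (- b))" by real_asymp
  moreover have "R \<in> O(\<lambda>n. real n powr (- b))" using R b by (simp add: rapidly_decreasing_def)
  ultimately have "R' \<in> O(\<lambda>n. real n powr (- b))"
    unfolding R'_def[abs_def] by (intro sum_in_bigo)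
  from bigo_uniform[OF this] obtain D where D: "D \<ge> 0" "\<And>n. 1 \<le> n \<Longrightarrow> \<bar>R' n\<bar> \<le> D * real n powr (- b)"
    by auto
  have "norm (T \<phi> - regular_distr \<Omega> (f n) \<phi>) \<le> (\<bar>C\<bar> * D) * real n powr (- b) * M"
    if a: "1 \<le> n" "\<phi> \<in> test_in K" "derivs_le N UNIV \<phi> M" for n \<phi> M
  proof -
    have "C * R' n \<le> \<bar>C\<bar> * (D * real n powr (- b))"
      using D(2)[OF a(1)] R'0[of n] by (intro mult_mono) auto
    from mult_right_mono[OF this derivs_le_nonneg[OF a(3) UNIV_I]]
    show ?thesis using C[OF a] by (simp add: mult.assoc)
  qed
  then show ?thesis using s b E 1 D(1)
    by (intro exI[of _ s] exI[of _ b] exI[of _ "\<bar>C\<bar> * D"] exI[of _ N]) auto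
qed

theorem theorem4p7:
  fixes \<Omega> :: "'a::euclidean_space set"
    and T :: "('a \<Rightarrow> complex) \<Rightarrow> complex"
    and k :: nat
    and f :: "nat \<Rightarrow> 'a \<Rightarrow> complex"
  assumes "open \<Omega>"
    and "T \<in> distributions \<Omega>"
    and "\<forall>n\<ge>1. Ck_on k \<Omega> (f n)"
    and "associated \<Omega> T f"
    and "((\<forall>a>0. f \<in> E_class k a \<Omega>) \<and>
          (\<exists>b>0. convergence_rate \<Omega> T f (\<lambda>n. real n powr (- b))))
       \<or> ((\<exists>s>0. f \<in> E_class k s \<Omega>) \<and>
          (\<exists>R. (\<forall>n. R n \<ge> 0) \<and> rapidly_decreasing R \<and> convergence_rate \<Omega> T f R))"
  shows "\<forall>\<eta>>0. T \<in> zygmund_loc (real k - \<eta>) \<Omega>"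
proof (intro allI impI)
  fix \<eta> :: real assume \<eta>: "\<eta> > 0"
  define \<beta> where "\<beta> = real k - \<eta>"
  \<comment> \<open>the least natural number greater than \<open>\<beta>\<close>, so that the moments of order less than \<open>l\<close> are those of
    order at most \<open>\<lfloor>\<beta>\<rfloor>\<close>; it is \<open>0\<close> if \<open>\<beta> < 0\<close>\<close>
  define l where "l = nat (\<lfloor>\<beta>\<rfloor> + 1)"
  define \<delta> where "\<delta> = real l - \<beta>"
  have lk: "l \<le> k" using \<eta> unfolding l_def \<beta>_def by linarith
  have \<delta>: "\<delta> > 0" unfolding \<delta>_def l_def by linarith
  have cont: "continuous_on \<Omega> (f n)" if "1 \<le> n" for n using assms(3) that Ck_on_continuous by blast
  have "mult_distr \<rho> T \<in> zygmund \<beta>" if \<rho>: "\<rho> \<in> test_functions \<Omega>" for \<rho>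
    unfolding zygmund_def
  proof (intro CollectI conjI allI impI mult_distr_tempered[OF assms(2) \<rho>])
    fix \<epsilon> and \<theta>\<^sub>1 \<theta> :: "'a \<Rightarrow> complex" assume "zygmund_admissible \<beta> \<epsilon> \<theta>\<^sub>1 \<theta>"
    then have \<theta>: "\<theta>\<^sub>1 \<in> schwartz_functions" "\<theta> \<in> schwartz_functions"
      and mom: "\<And>m. m \<in> multi_indices \<Longrightarrow> int (order_mi m) \<le> \<lfloor>\<beta>\<rfloor> \<Longrightarrow> (LINT z|lborel. of_real (monomial m z) * \<theta> z) = 0"
      by (auto simp: zygmund_admissible_def)
    define K where "K = supp \<rho>"
    have K: "compact K" "K \<subseteq> \<Omega>" and \<rho>K: "\<rho> \<in> test_in K"
      using \<rho> test_functions_in[OF \<rho>] by (auto simp: K_def test_functions_def)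
    obtain s b C1 N where sb: "s > 0" "b > 0" "s * (real (DIM('a) + N) + \<beta>) \<le> b * \<delta>"
      and E: "f \<in> E_class k s \<Omega>" and C1: "C1 \<ge> 0" "\<And>n \<phi> M. 1 \<le> n \<Longrightarrow> \<phi> \<in> test_in K \<Longrightarrow> derivs_le N UNIV \<phi> M \<Longrightarrow>
        norm (T \<phi> - regular_distr \<Omega> (f n) \<phi>) \<le> C1 * real n powr (- b) * M"
      using rate_exponents[OF assms(2) K cont assms(5) \<delta>, of \<beta>] by blast
    have "(LINT z|lborel. of_real (monomial m z) * \<theta> z) = 0" if "m \<in> multi_indices" "order_mi m < l" for m
      using that by (intro mom) (auto simp: l_def)
    then obtain C2 where C2: "C2 \<ge> 0" "\<And>n j x. 1 \<le> n \<Longrightarrow> 1 \<le> j \<Longrightarrow>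
        norm (regular_distr \<Omega> (f n) (\<lambda>y. \<rho> y * dyadic \<theta>\<^sub>1 \<theta> j (x - y))) \<le> C2 * real n powr s * (1/2) ^ (j * l)"
      using regular_part_estimate[OF assms(1) E \<rho> lk \<theta>(2), of \<theta>\<^sub>1] by blast
    let ?\<phi> = "\<lambda>j x y. \<rho> y * dyadic \<theta>\<^sub>1 \<theta> j (x - y)"
    have in_K: "?\<phi> j x \<in> test_in K" for j x by (rule dyadic_test_functions(1)[OF K(1) \<rho>K \<theta>])
    obtain B where B: "B \<ge> 0" "\<And>j x. derivs_le N UNIV (?\<phi> j x) (B * 2 ^ (j * (DIM('a) + N)))"
      using dyadic_test_functions(2)[OF K(1) \<rho>K \<theta>] by blast
    obtain C0 N0 where C0: "\<And>\<phi> M. \<phi> \<in> test_in K \<Longrightarrow> derivs_le N0 UNIV \<phi> M \<Longrightarrow> norm (T \<phi>) \<le> C0 * M"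
      using distribution_estimate[OF assms(2) K] by blast
    obtain B0 where B0: "\<And>j x. derivs_le N0 UNIV (?\<phi> j x) (B0 * 2 ^ (j * (DIM('a) + N0)))"
      using dyadic_test_functions(2)[OF K(1) \<rho>K \<theta>] by blast
    have conv: "conv_distr (mult_distr \<rho> T) (dyadic \<theta>\<^sub>1 \<theta> j) x = T (?\<phi> j x)" for j x
      by (simp add: conv_distr_def mult_distr_def)
    \<comment> \<open>no moments of \<open>\<theta>\<^sub>1\<close> need vanish, but for the single index \<open>j = 0\<close> the continuity of \<open>T\<close> suffices\<close>
    have zero: "norm (T (?\<phi> 0 x)) \<le> C0 * B0" for x using C0[OF in_K B0, of 0 x] by simp
    have pos: "2 powr (\<beta> * real j) * norm (T (?\<phi> j x)) \<le> C1 * B + C2 * 2 powr s" if j: "1 \<le> j" for j x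
    proof -
      define Q where "Q = real (DIM('a) + N)"
      obtain n where n: "n \<ge> 1" "2 powr (\<beta> * real j) * (real n powr s * 2 powr (- (\<beta> + \<delta>) * real j)) \<le> 2 powr s"
        "2 powr (\<beta> * real j) * (2 powr (Q * real j) * real n powr (- b)) \<le> 1"
        using balance_index[OF sb(1,2) \<delta>, of Q \<beta> j] sb(3) unfolding Q_def by blast
      have p1: "(2::real) ^ (j * (DIM('a) + N)) = 2 powr (Q * real j)"
        unfolding Q_def by (subst powr_realpow[symmetric]) (simp_all add: mult.commute)
      have p2: "(1/2::real) ^ (j * l) = 2 powr (- (\<beta> + \<delta>) * real j)"
        unfolding \<delta>_def by (simp add: powr_minus powr_realpow[symmetric] power_one_over inverse_eq_divide mult.commute)
      have "norm (T (?\<phi> j x)) \<le> norm (T (?\<phi> j x) - regular_distr \<Omega> (f n) (?\<phi> j x)) + norm (regular_distr \<Omega> (f n) (?\<phi> j x))"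
        using norm_triangle_ineq[of "T (?\<phi> j x) - regular_distr \<Omega> (f n) (?\<phi> j x)" "regular_distr \<Omega> (f n) (?\<phi> j x)"] by simp
      also have "\<dots> \<le> C1 * real n powr (- b) * (B * 2 ^ (j * (DIM('a) + N))) + C2 * real n powr s * (1/2) ^ (j * l)"
        by (intro add_mono C1(2)[OF n(1) in_K B(2)] C2(2)[OF n(1) j])
      also have "\<dots> = (C1 * B) * (2 powr (Q * real j) * real n powr (- b)) + C2 * (real n powr s * 2 powr (- (\<beta> + \<delta>) * real j))"
        unfolding p1 p2 by (simp add: mult_ac)
      finally have "2 powr (\<beta> * real j) * norm (T (?\<phi> j x)) \<le> 2 powr (\<beta> * real j) *
          ((C1 * B) * (2 powr (Q * real j) * real n powr (- b)) + C2 * (real n powr s * 2 powr (- (\<beta> + \<delta>) * real j)))"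
        by (intro mult_left_mono) auto
      also have "\<dots> = (C1 * B) * (2 powr (\<beta> * real j) * (2 powr (Q * real j) * real n powr (- b)))
          + C2 * (2 powr (\<beta> * real j) * (real n powr s * 2 powr (- (\<beta> + \<delta>) * real j)))"
        by (simp only: distrib_left mult_ac)
      also have "\<dots> \<le> (C1 * B) * 1 + C2 * 2 powr s"
        using C1(1) C2(1) B(1) by (intro add_mono mult_left_mono n) auto
      finally show ?thesis by simp
    qed
    show "\<exists>C. \<forall>x j. 2 powr (\<beta> * real j) * norm (conv_distr (mult_distr \<rho> T) (dyadic \<theta>\<^sub>1 \<theta> j) x) \<le> C"
    proof (intro exI allI)
      fix x j
      show "2 powr (\<beta> * real j) * norm (conv_distr (mult_distr \<rho> T) (dyadic \<theta>\<^sub>1 \<theta> j) x)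
          \<le> max (C0 * B0) (C1 * B + C2 * 2 powr s)"
        unfolding conv using zero[of x] pos[of j x] by (cases "j = 0") (auto simp: max_def)
    qed
  qed
  then show "T \<in> zygmund_loc (real k - \<eta>) \<Omega>"
    using assms(2) unfolding zygmund_loc_def \<beta>_def by blast
qed

end
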